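(* Let $d\ge 1$, let $\lambda_w,\lambda_x,\lambda_v>0$, and let $\mu_t$, $t\ge 0$, be the measure-valued solution of the kinetic herding equation subjected to initial data $\mu_0$, a compactly supported Radon measure on $\mathbb{R}^{2d}$ of total mass $1$. Assume that the communication rate $\phi$ is smooth, Lipschitz continuous, satisfies $\phi(r)=\phi(-r)$ and $(\phi(r)-\phi(s))(r-s)\le 0$ for all $r,s\ge 0$, and that $\phi_m\le\phi\le\phi_M$ for some positive constants $\phi_m$ and $\phi_M$. Assume further that \[ \frac{\phi_M\lambda_x^2}{\phi_m\lambda_w\lambda_v^2}<\frac12\min(1,\phi_M). \] Then there exist positive constants $C$ and $\beta$ such that, for all $t\ge 0$, \[ \int_{\mathbb{R}^{2d}}\big(|x-x_c(t)|^2+|v-v_c(t)|^2\big)\,\mu_t(dx,dv)\le C e^{-\frac{\beta}{2}t}, \] where $x_c(t)=\int x\,\mu_t(dx,dv)$, $v_c(t)=\int v\,\mu_t(dx,dv)$, the constant $C=C(\mu_0,\lambda_w,\lambda_x,\lambda_v)$ is positive, and $\beta=\beta(\phi_m,\phi_M,\lambda_w,\lambda_x,\lambda_v)$ is given by \[ \beta=\min\left\{1-\theta,\;-1+\frac{\theta\lambda_w\lambda_v^2}{\phi_M\lambda_x^2}\phi_m\right\}\alpha\,\delta, \] with \[ \theta=\frac12\min(1,\phi_M),\qquad \alpha=\frac{2\lambda_x}{\lambda_v\left(1+2\frac{\theta\lambda_w}{\phi_M\lambda_x}\right)}, \] and $\delta$ a number chosen to satisfy $0<\delta<1$ and $\d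frac{\delta^2}{(1-\delta)^2}<\dfrac{4\lambda_w}{\alpha^2}$.
   Context: The kinetic herding equation is \[ \partial_t f+v\cdot\nabla_x f+\nabla_v\cdot(Q(f)f)=0,\qquad (x,v)\in\mathbb{R}^d\times\mathbb{R}^d, \] where, for a measure $\mu_s$ on $\mathbb{R}^{2d}$, the non-local force is \[ Q(x,v,\mu_s)=\int_{\mathbb{R}^{2d}}\Big[\lambda_w(x^*-x)+\lambda_x\phi(|x-x^*|)(x^*-x)+\lambda_v\phi(|x-x^*|)(v^*-v)\Big]\mu_s(dx^*,dv^* ). \] Here $\phi:\mathbb{R}\to[0,\infty)$ is the communication rate and $\lambda_w,\lambda_x,\lambda_v$ are the interaction strengths. $\mathcal{M}(\mathbb{R}^{2d})$ is the space of nonnegative (finite) Radon measures, viewed in the dual of $C_0(\mathbb{R}^{2d})$, with $\langle\nu,g\rangle=\int g(x,v)\,\nu(dx,dv)$. $C_0^1$ denotes $C^1$ functions with compact support. Measure-valued solution: for $T\in(0,\infty)$, $\mu\in L^\infty([0,T);\mathcal{M}(\mathbb{R}^{2d}))$ is a measure-valued solution with initial measure $\mu_0$ if (1) $t\mapsto\langle\mu_t,g\rangle$ is continuous for all $g\in C_0(\mathbb{R}^{2d})$; and (2) for all $g\in C_0^1(\mathbb{R}^{2d}\times[0,T))$, \[ \langle\mu_t,g(\cdot,\cdot,t)\rangle-\langle\mu_0,g(\cdot,\cdot,0)\rangle=\int_0^t\langle\mu_s,\partial_s g+v\cdot\nabla_x g+Q(\cdot,\cdot,\mu_s)\cdot\nabla_v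 g\rangle\,ds . \] For compactly supported $\mu_0$ such a solution exists and is unique on $[0,T)$ for every $T$; $\mu_t$, $t\ge0$, denotes the resulting global solution. *)

theory Defs
  imports "HOL-Analysis.Analysis"
begin

type_synonym 'd phase = "(real ^ 'd) \<times> (real ^ 'd)"

text \<open>A point of phase space is a pair \<open>(x, v)\<close>; the norm of the product type is the Euclidean
  one, so this is \<open>\<real>\<^sup>2\<^sup>d\<close> with \<open>d = CARD('d) \<ge> 1\<close>. Every finite Borel measure on it is Radon.\<close>

definition finite_borel :: "'a::topological_space measure \<Rightarrow> bool" where
  "finite_borel \<nu> \<longleftrightarrow> sets \<nu> = sets borel \<and> finite_measure \<nu>"

definition compactly_supported :: "'a::topological_space measure \<Rightarrow> bool" where
  "compactly_supported \<nu> \<longleftrightarrow> (\<exists>K. compact K \<and> emeasure \<nu> (- K) = 0)"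

definition smooth :: "(real \<Rightarrow> real) \<Rightarrow> bool" where
  "smooth f \<longleftrightarrow> (\<forall>n r. (deriv ^^ n) f differentiable (at r))"

definition communication_rate :: "(real \<Rightarrow> real) \<Rightarrow> real \<Rightarrow> real \<Rightarrow> bool" where
  "communication_rate \<phi> \<phi>m \<phi>M \<longleftrightarrow>
     smooth \<phi> \<and> (\<exists>L. L-lipschitz_on UNIV \<phi>) \<and>
     (\<forall>r. \<phi> r = \<phi> (- r)) \<and>
     (\<forall>r\<ge>0. \<forall>s\<ge>0. (\<phi> r - \<phi> s) * (r - s) \<le> 0) \<and>
     0 < \<phi>m \<and> 0 < \<phi>M \<and> (\<forall>r. \<phi>m \<le> \<phi> r \<and> \<phi> r \<le> \<phi>M)"

text \<open>The interaction strengths are written \<open>lw\<close>, \<open>lx\<close>, \<open>lv\<close>.\<close>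

definition herding_force ::
  "real \<Rightarrow> real \<Rightarrow> real \<Rightarrow> (real \<Rightarrow> real) \<Rightarrow> real ^ 'd \<Rightarrow> real ^ 'd \<Rightarrow> ('d::finite) phase measure \<Rightarrow> real ^ 'd"
where
  "herding_force lw lx lv \<phi> x v \<nu> =
     (LINT z|\<nu>. lw *\<^sub>R (fst z - x)
              + (lx * \<phi> (norm (x - fst z))) *\<^sub>R (fst z - x)
              + (lv * \<phi> (norm (x - fst z))) *\<^sub>R (snd z - v))"

definition C_0 :: "('a::real_normed_vector \<Rightarrow> real) set" where
  "C_0 = {g. continuous_on UNIV g \<and> (g \<longlongrightarrow> 0) at_infinity}"

text \<open>\<open>C1_test T g g'\<close>: \<open>g\<close> is a compactly supported \<open>C\<^sup>1\<close> function on \<open>\<real>\<^sup>2\<^sup>d \<times> [0,T)\<close> with derivative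
  \<open>g'\<close>, one-sided in time at \<open>t = 0\<close>. The support may meet \<open>t = 0\<close> but stays away from \<open>t = T\<close>.
  Derivatives within this set are unique, so \<open>g'\<close> is determined there by \<open>g\<close>.\<close>

definition C1_test ::
  "real \<Rightarrow> (('d::finite) phase \<times> real \<Rightarrow> real) \<Rightarrow> ('d phase \<times> real \<Rightarrow> ('d phase \<times> real) \<Rightarrow>\<^sub>L real) \<Rightarrow> bool"
where
  "C1_test T g g' \<longleftrightarrow>
     (let S = UNIV \<times> {0..<T} in
        (\<forall>p\<in>S. (g has_derivative blinfun_apply (g' p)) (at p within S)) \<and>
        continuous_on S g' \<and>
        (\<exists>K. compact K \<and> K \<subseteq> S \<and> (\<forall>p\<in>S - K. g p = 0)))"

text \<open>\<open>\<partial>\<^sub>s g + v \<cdot> \<nabla>\<^sub>x g + Q \<cdot> \<nabla>\<^sub>v g\<close> at \<open>((x, v), s)\<close>: the summands are the derivative \<open>g'\<close> applied to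
  the unit time direction, to \<open>v\<close> in the position slot and to \<open>Q\<close> in the velocity slot.\<close>

definition transport ::
  "real \<Rightarrow> real \<Rightarrow> real \<Rightarrow> (real \<Rightarrow> real) \<Rightarrow> ('d::finite) phase measure \<Rightarrow>
   ('d phase \<times> real \<Rightarrow> ('d phase \<times> real) \<Rightarrow>\<^sub>L real) \<Rightarrow> real \<Rightarrow> 'd phase \<Rightarrow> real"
where
  "transport lw lx lv \<phi> \<nu> g' s = (\<lambda>(x, v).
       blinfun_apply (g' ((x, v), s)) ((0, 0), 1)
     + blinfun_apply (g' ((x, v), s)) ((v, 0), 0)
     + blinfun_apply (g' ((x, v), s)) ((0, herding_force lw lx lv \<phi> x v \<nu>), 0))"

text \<open>The third clause (finite first moments) says that the integrals defining the force, and the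
  means of \<open>x\<close> and \<open>v\<close>, exist; the Bochner integral would otherwise silently be \<open>0\<close>. For the same
  reason integrability in time is demanded explicitly in the weak formulation.\<close>

definition measure_valued_solution ::
  "real \<Rightarrow> real \<Rightarrow> real \<Rightarrow> (real \<Rightarrow> real) \<Rightarrow> real \<Rightarrow> ('d::finite) phase measure \<Rightarrow> (real \<Rightarrow> 'd phase measure) \<Rightarrow> bool"
where
  "measure_valued_solution lw lx lv \<phi> T \<mu>0 \<mu> \<longleftrightarrow>
     (\<forall>t\<in>{0..<T}. finite_borel (\<mu> t)) \<and>
     (\<exists>B. AE t in lborel. t \<in> {0..<T} \<longrightarrow> measure (\<mu> t) UNIV \<le> B) \<and>
     (\<forall>t\<in>{0..<T}. integrable (\<mu> t) (\<lambda>z. z)) \<and>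
     \<mu> 0 = \<mu>0 \<and>
     (\<forall>g\<in>C_0. continuous_on {0..<T} (\<lambda>t. LINT z|\<mu> t. g z)) \<and>
     (\<forall>g g'. C1_test T g g' \<longrightarrow> (\<forall>t\<in>{0..<T}.
        set_integrable lborel {0..t} (\<lambda>s. LINT z|\<mu> s. transport lw lx lv \<phi> (\<mu> s) g' s z) \<and>
        (LINT z|\<mu> t. g (z, t)) - (LINT z|\<mu>0. g (z, 0)) =
          (LINT s:{0..t}|lborel. (LINT z|\<mu> s. transport lw lx lv \<phi> (\<mu> s) g' s z))))"

definition global_solution ::
  "real \<Rightarrow> real \<Rightarrow> real \<Rightarrow> (real \<Rightarrow> real) \<Rightarrow> ('d::finite) phase measure \<Rightarrow> (real \<Rightarrow> 'd phase measure) \<Rightarrow> bool"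
where
  "global_solution lw lx lv \<phi> \<mu>0 \<mu> \<longleftrightarrow> (\<forall>T>0. measure_valued_solution lw lx lv \<phi> T \<mu>0 \<mu>)"

definition mean_x :: "('d::finite) phase measure \<Rightarrow> real ^ 'd" where
  "mean_x \<nu> = (LINT z|\<nu>. fst z)"

definition mean_v :: "('d::finite) phase measure \<Rightarrow> real ^ 'd" where
  "mean_v \<nu> = (LINT z|\<nu>. snd z)"

end

(* Let (x, v) and (y, w) be independent with law mu_t and put X = x - y, V = v - w. The functional
   E = 1/2 * the mean of lw |X|^2 + alpha X.V + |V|^2 is comparable with the variance of mu_t, because
   the smallness condition forces alpha^2 < 2 lw. Antisymmetry of the interaction turns E' into the
   mean of a quadratic form in (X, V), which Young's inequality bounds by -beta/2 times the integrand
   of E. The comparison constants depend on lw only, hence C on lw and mu_0 only.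

   A solution in the sense of the definition has finite first moments, but without any uniformity
   in time. A Baire category argument shows that the first moment is locally bounded. Then mass is
   conserved, and the compact support of mu_0 gives a locally bounded second moment, so that
   quadratic test functions are admissible. *)

theory Submission
  imports Defs "HOL-Real_Asymp.Real_Asymp"
begin

section \<open>Weights and cutoffs\<close>

text \<open>The weak formulation admits only compactly supported test functions. Removing a cutoff
  needs moments bounded uniformly on a time interval, yet the natural source of such bounds is the
  same formulation with an unbounded test function. The way out is to separate finiteness from size:
  the Gronwall lemma assumes some upper bound, uses it only to know that a supremum is finite, and
  concludes with constants that do not contain it. This works because the growth rate of the first
  moment involves, besides the coefficients, the mass alone.

  No equation for the product measure is needed. Total momentum is conserved, so the mean moves
  uniformly, and E is a quadratic moment of \<open>\<mu> t\<close> minus the same form at the mean;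
  pairs enter only at a fixed time. E satisfies an integral identity and is never differentiated.

  In the rate, \<theta> is the share of the attraction \<open>lw\<close> spent on Young's
  inequality. The smallness condition says exactly that the second entry of the minimum in \<beta>
  is positive; \<theta> being at most 1/2 takes care of the first.\<close>

definition bracket :: "'a::real_inner \<Rightarrow> real" where
  "bracket z = sqrt (1 + z \<bullet> z)"

text \<open>Squaring the positive part is the cheapest way to a C^1 function that vanishes on a
  half-line; the same function cuts off in space and in time.\<close>

definition ramp :: "real \<Rightarrow> real" where
  "ramp u = (max 0 u)\<^sup>2"

definition cutoff :: "real \<Rightarrow> 'a::real_inner \<Rightarrow> real" where
  "cutoff n z = ramp (1 - (z \<bullet> z) / n\<^sup>2)"

definition cutoff_grad :: "real \<Rightarrow> 'a::real_inner \<Rightarrow> 'a" where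
  "cutoff_grad n z = - (4 * max 0 (1 - (z \<bullet> z) / n\<^sup>2) / n\<^sup>2) *\<^sub>R z"

lemma bracket_ge_1: "bracket z \<ge> 1"
  and bracket_pos: "bracket z > 0"
  and norm_le_bracket: "norm z \<le> bracket z"
  and bracket_sq: "(bracket z)\<^sup>2 = 1 + z \<bullet> z"
  and bracket_le: "bracket z \<le> 1 + norm z"
proof -
  show 1: "bracket z \<ge> 1" by (simp add: bracket_def)
  then show "bracket z > 0" by linarith
  show "norm z \<le> bracket z" by (simp add: bracket_def norm_eq_sqrt_inner)
  show sq: "(bracket z)\<^sup>2 = 1 + z \<bullet> z" by (simp add: bracket_def)
  show "bracket z \<le> 1 + norm z"
    by (rule power2_le_imp_le) (simp_all add: sq power2_sum power2_norm_eq_inner)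
qed

lemma GDERIV_inner_self: "GDERIV (\<lambda>z. z \<bullet> z) z :> 2 *\<^sub>R z"
  unfolding gderiv_def
  by (rule has_derivative_eq_rhs [OF has_derivative_inner [OF has_derivative_ident has_derivative_ident]])
    (simp add: fun_eq_iff inner_commute [of z])

lemma GDERIV_bracket: "GDERIV bracket z :> (1 / bracket z) *\<^sub>R z"
proof -
  have "GDERIV (\<lambda>z. 1 + z \<bullet> z) z :> 0 + 2 *\<^sub>R z"
    by (intro GDERIV_add GDERIV_const GDERIV_inner_self)
  moreover have "DERIV sqrt (1 + z \<bullet> z) :> inverse (sqrt (1 + z \<bullet> z)) / 2"
    by (rule DERIV_real_sqrt) (smt (verit) inner_ge_zero)
  ultimately have "GDERIV (\<lambda>z. sqrt (1 + z \<bullet> z)) z :>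
      (inverse (sqrt (1 + z \<bullet> z)) / 2) *\<^sub>R (0 + 2 *\<^sub>R z)"
    by (rule GDERIV_DERIV_compose)
  then show ?thesis by (simp add: bracket_def [abs_def] inverse_eq_divide)
qed

lemma continuous_on_bracket [continuous_intros]:
  "continuous_on S f \<Longrightarrow> continuous_on S (\<lambda>x. bracket (f x))"
  unfolding bracket_def by (intro continuous_intros)

lemma DERIV_ramp: "DERIV ramp u :> 2 * max 0 u"
proof -
  consider "u > 0" | "u < 0" | "u = 0" by linarith
  then show ?thesis
  proof cases
    case 1
    have "DERIV (\<lambda>u. u\<^sup>2) u :> 2 * max 0 u"
      using 1 by (auto intro!: derivative_eq_intros)
    then show ?thesis
      by (rule has_field_derivative_transform_within_open [of _ _ _ "{0<..}"])
        (use 1 in \<open>auto simp: ramp_def\<close>)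
  next
    case 2
    have "DERIV (\<lambda>u. 0) u :> 2 * max 0 u"
      using 2 by (auto intro!: derivative_eq_intros)
    then show ?thesis
      by (rule has_field_derivative_transform_within_open [of _ _ _ "{..<0}"])
        (use 2 in \<open>auto simp: ramp_def\<close>)
  next
    case 3
    have "((\<lambda>h::real. max 0 h) \<longlongrightarrow> 0) (at 0)"
      using tendsto_max [OF tendsto_const tendsto_ident_at, of "0::real" 0 UNIV] by simp
    moreover have "max 0 h = ramp h / h" if "h \<noteq> 0" for h
      using that by (cases "h > 0") (auto simp: ramp_def power2_eq_square)
    ultimately have "((\<lambda>h. ramp h / h) \<longlongrightarrow> 0) (at 0)"
      using LIM_equal [of 0 "\<lambda>h. max 0 h" "\<lambda>h. ramp h / h" 0] by blast
    then show ?thesis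
      using 3 by (simp add: DERIV_def ramp_def)
  qed
qed

lemma continuous_on_ramp [continuous_intros]:
  "continuous_on S f \<Longrightarrow> continuous_on S (\<lambda>x. ramp (f x))"
  unfolding ramp_def by (intro continuous_intros)

lemma continuous_on_cutoff [continuous_intros]: "continuous_on S (cutoff n)"
proof (cases "n = 0")
  case False
  then show ?thesis unfolding cutoff_def [abs_def] by (intro continuous_intros) auto
qed (simp add: cutoff_def [abs_def])

lemma continuous_on_cutoff_grad [continuous_intros]: "continuous_on S (cutoff_grad n)"
proof (cases "n = 0")
  case False
  then show ?thesis unfolding cutoff_grad_def [abs_def] by (intro continuous_intros) auto
qed (simp add: cutoff_grad_def [abs_def])

lemma GDERIV_cutoff: "GDERIV (cutoff n) z :> cutoff_grad n z"
proof -
  have "GDERIV (\<lambda>z. 1 - (1 / n\<^sup>2) * (z \<bullet> z)) z :>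
      0 - ((1 / n\<^sup>2) *\<^sub>R (2 *\<^sub>R z) + (z \<bullet> z) *\<^sub>R 0)"
    by (intro GDERIV_diff GDERIV_const GDERIV_mult GDERIV_inner_self)
  then have "GDERIV (\<lambda>z. 1 - (z \<bullet> z) / n\<^sup>2) z :> (- 2 / n\<^sup>2) *\<^sub>R z"
    by simp
  from GDERIV_DERIV_compose [OF this DERIV_ramp] show ?thesis
    by (simp add: cutoff_def [abs_def] cutoff_grad_def mult.commute)
qed

lemma cutoff_nonneg: "0 \<le> cutoff n z" and cutoff_le_1: "cutoff n z \<le> 1"
proof -
  show "0 \<le> cutoff n z" by (simp add: cutoff_def ramp_def)
  have "max 0 (1 - z \<bullet> z / n\<^sup>2) \<le> 1" by simp
  then show "cutoff n z \<le> 1"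
    unfolding cutoff_def ramp_def by (intro power_le_one max.cobounded1)
qed

lemma cutoff_eq_0: "n > 0 \<Longrightarrow> n \<le> norm z \<Longrightarrow> cutoff n z = 0"
proof -
  assume n: "n > 0" "n \<le> norm z"
  then have "n\<^sup>2 \<le> z \<bullet> z"
    using power_mono [of n "norm z" 2] by (simp add: power2_norm_eq_inner)
  then have "1 \<le> z \<bullet> z / n\<^sup>2" using n by (simp add: le_divide_eq)
  then show ?thesis by (simp add: cutoff_def ramp_def)
qed

text \<open>The gradient is of order 1/n and lives on a ball where the weight is of order n, so the
  product is bounded uniformly in \<open>n\<close>. Hence multiplying a test function by the cutoff
  does not worsen the growth of its gradient.\<close>

lemma norm_cutoff_grad_le:
  assumes "n \<ge> 1"
  shows "norm (cutoff_grad n z) * bracket z \<le> 8"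
proof (cases "z \<bullet> z \<le> n\<^sup>2")
  case True
  have n: "1 \<le> n\<^sup>2" using assms by simp
  have "norm z * bracket z \<le> (bracket z)\<^sup>2"
    using norm_le_bracket [of z] bracket_pos [of z] by (simp add: power2_eq_square)
  also have "\<dots> \<le> 2 * n\<^sup>2" using True n by (simp add: bracket_sq)
  finally have 1: "norm z * bracket z \<le> 2 * n\<^sup>2" .
  have "norm (cutoff_grad n z) * bracket z
      = 4 * max 0 (1 - (z \<bullet> z) / n\<^sup>2) * (norm z * bracket z / n\<^sup>2)"
    by (simp add: cutoff_grad_def)
  also have "\<dots> \<le> 4 * 1 * 2"
    using 1 n by (intro mult_mono divide_nonneg_nonneg mult_nonneg_nonneg)
      (auto simp: divide_le_eq bracket_pos less_imp_le)
  finally show ?thesis by simp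
next
  case False
  then have "1 \<le> z \<bullet> z / n\<^sup>2" using assms by (simp add: le_divide_eq)
  then have "cutoff_grad n z = 0" by (simp add: cutoff_grad_def)
  then show ?thesis by simp
qed

lemma cutoff_tendsto: "(\<lambda>k. cutoff (real (Suc k)) z) \<longlonglongrightarrow> 1"
  and cutoff_grad_tendsto: "(\<lambda>k. cutoff_grad (real (Suc k)) z) \<longlonglongrightarrow> 0"
proof -
  have 0: "(\<lambda>k. 1 / (real (Suc k))\<^sup>2) \<longlonglongrightarrow> 0"
    by real_asymp
  have 1: "(\<lambda>k. 1 - (z \<bullet> z) * (1 / (real (Suc k))\<^sup>2)) \<longlonglongrightarrow> 1 - (z \<bullet> z) * 0"
    by (intro tendsto_intros 0)
  then have "(\<lambda>k. (max 0 (1 - (z \<bullet> z) * (1 / (real (Suc k))\<^sup>2)))\<^sup>2) \<longlonglongrightarrow> (max 0 (1 - (z \<bullet> z) * 0))\<^sup>2"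
    by (intro tendsto_intros 0)
  then show "(\<lambda>k. cutoff (real (Suc k)) z) \<longlonglongrightarrow> 1"
    by (simp add: cutoff_def ramp_def)
  have "(\<lambda>k. - (4 * max 0 (1 - (z \<bullet> z) * (1 / (real (Suc k))\<^sup>2)) * (1 / (real (Suc k))\<^sup>2)) *\<^sub>R z)
      \<longlonglongrightarrow> - (4 * max 0 (1 - (z \<bullet> z) * 0) * 0) *\<^sub>R z"
    by (intro tendsto_intros 0)
  then show "(\<lambda>k. cutoff_grad (real (Suc k)) z) \<longlonglongrightarrow> 0"
    by (simp add: cutoff_grad_def)
qed

lemma compact_support_in_C_0:
  assumes "continuous_on UNIV g" "\<And>z. norm z \<ge> R \<Longrightarrow> g z = 0"
  shows "g \<in> C_0"
proof -
  have "eventually (\<lambda>z. g z = 0) at_infinity"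
    unfolding eventually_at_infinity using assms(2) by blast
  then show ?thesis
    using assms(1) by (simp add: C_0_def tendsto_eventually)
qed

section \<open>The weak formulation\<close>

locale herding =
  fixes lw lx lv :: real and \<phi> :: "real \<Rightarrow> real" and \<phi>m \<phi>M :: real
    and \<mu>0 :: "('d::finite) phase measure" and \<mu> :: "real \<Rightarrow> 'd phase measure"
  assumes lw: "lw > 0" and lx: "lx > 0" and lv: "lv > 0"
    and rate: "communication_rate \<phi> \<phi>m \<phi>M"
    and sol: "global_solution lw lx lv \<phi> \<mu>0 \<mu>"
    and compact_0: "compactly_supported \<mu>0" and mass_0: "measure \<mu>0 UNIV = 1"
begin

text \<open>The velocity field of the characteristics in phase space; with it the two transport
  terms become one inner product with the full gradient.\<close>

definition F :: "real \<Rightarrow> 'd phase \<Rightarrow> 'd phase" where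
  "F r z = (snd z, herding_force lw lx lv \<phi> (fst z) (snd z) (\<mu> r))"

text \<open>The surplus 2 leaves room to the right of \<open>t\<close>, both for continuity at
  \<open>t\<close> and for a time cutoff that ends before the horizon.\<close>

lemma sol_on: "t \<ge> 0 \<Longrightarrow> measure_valued_solution lw lx lv \<phi> (t + 2) \<mu>0 \<mu>"
  using sol by (simp add: global_solution_def)

lemma borel_mu: "t \<ge> 0 \<Longrightarrow> finite_borel (\<mu> t)"
  and integrable_id: "t \<ge> 0 \<Longrightarrow> integrable (\<mu> t) (\<lambda>z. z)"
  and mu_0: "\<mu> 0 = \<mu>0"
  using sol_on [of t] sol_on [of 0] by (auto simp: measure_valued_solution_def)

lemma sets_mu [measurable_cong]: "t \<ge> 0 \<Longrightarrow> sets (\<mu> t) = sets borel"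
  and finite_mu: "t \<ge> 0 \<Longrightarrow> finite_measure (\<mu> t)"
  using borel_mu by (auto simp: finite_borel_def)

lemma space_mu: "t \<ge> 0 \<Longrightarrow> space (\<mu> t) = UNIV"
  using sets_eq_imp_space_eq [OF sets_mu] by simp

lemma measurable_mu: "t \<ge> 0 \<Longrightarrow> continuous_on UNIV f \<Longrightarrow> f \<in> borel_measurable (\<mu> t)"
  using measurable_cong_sets [OF sets_mu refl] borel_measurable_continuous_onI by blast

lemma continuous_pairing:
  assumes "g \<in> C_0"
  shows "continuous_on {0..} (\<lambda>t. LINT z|\<mu> t. g z)"
proof -
  have "continuous (at t within {0..}) (\<lambda>t. LINT z|\<mu> t. g z)" if "t \<ge> 0" for t
  proof -
    have "continuous_on {0..<t + 2} (\<lambda>t. LINT z|\<mu> t. g z)"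
      using sol_on [OF that] assms by (auto simp: measure_valued_solution_def)
    then have "continuous (at t within {0..<t + 2}) (\<lambda>t. LINT z|\<mu> t. g z)"
      using that by (simp add: continuous_on_eq_continuous_within)
    moreover have "at t within {0..<t + 2} = at t within {0..}"
      by (rule at_within_nhd [of _ "{..<t + 2}"]) auto
    ultimately show ?thesis by simp
  qed
  then show ?thesis by (simp add: continuous_on_eq_continuous_within)
qed

text \<open>A test function independent of time is made admissible by a time cutoff that equals 1 on
  the interval considered, so its time derivative does not contribute. The identity on
  \<open>{s..t}\<close> is the difference of those on \<open>{0..t}\<close> and
  \<open>{0..s}\<close>, which share only a null set.\<close>

lemma weak_compact_support:
  assumes G: "\<And>z. GDERIV \<psi> z :> G z" and cG: "continuous_on UNIV G"
    and K: "compact K" "\<And>z. z \<notin> K \<Longrightarrow> \<psi> z = 0"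
    and st: "0 \<le> s" "s \<le> t"
  shows "set_integrable lborel {s..t} (\<lambda>r. LINT z|\<mu> r. F r z \<bullet> G z)"
    and "(LINT z|\<mu> t. \<psi> z) - (LINT z|\<mu> s. \<psi> z) = (LINT r:{s..t}|lborel. (LINT z|\<mu> r. F r z \<bullet> G z))"
proof -
  \<comment> \<open>The time cutoff \<open>\<eta>\<close> is \<open>1\<close> up to \<open>t\<close> and \<open>0\<close> from \<open>t + 1\<close> on, so that the test function stays away
    from the end \<open>t + 2\<close> of the time interval.\<close>
  define \<eta> where "\<eta> = (\<lambda>r. ramp (1 - ramp (r - t)))"
  define \<eta>' where "\<eta>' = (\<lambda>r. 2 * max 0 (1 - ramp (r - t)) * - (2 * max 0 (r - t)))"
  define g where "g = (\<lambda>p. \<psi> (fst p) * \<eta> (snd p))"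
  \<comment> \<open>The derivative is encoded by its gradient in phase space times time: the phase
    component is the cut-off \<open>G\<close>, the time component comes from differentiating the
    cutoff.\<close>
  define g' where "g' = (\<lambda>p::'d phase \<times> real. blinfun_inner_left (\<eta> (snd p) *\<^sub>R G (fst p), \<psi> (fst p) * \<eta>' (snd p)))"
  have \<eta>1: "\<eta> r = 1" "\<eta>' r = 0" if "r \<le> t" for r
    using that by (auto simp: \<eta>_def \<eta>'_def ramp_def)
  have \<eta>0: "\<eta> r = 0" if "r \<ge> t + 1" for r
    using that one_le_power [of "r - t" 2] by (simp add: \<eta>_def ramp_def)
  have d\<eta>: "DERIV \<eta> r :> \<eta>' r" for r
    unfolding \<eta>_def \<eta>'_def
    by (rule DERIV_chain2 [OF DERIV_ramp])
      (auto intro!: derivative_eq_intros DERIV_chain2 [OF DERIV_ramp])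
  have c\<psi>: "continuous_on UNIV \<psi>"
    using G unfolding gderiv_def
    by (meson continuous_at_imp_continuous_on has_derivative_continuous)
  have dg: "(g has_derivative blinfun_apply (g' p)) (at p within A)" for p A
  proof -
    have 1: "((\<lambda>p. \<psi> (fst p)) has_derivative (\<lambda>h. fst h \<bullet> G (fst p))) (at p within A)"
      using G [of "fst p", unfolded gderiv_def]
      by (rule has_derivative_compose [OF has_derivative_fst [OF has_derivative_ident]])
    have 2: "((\<lambda>p. \<eta> (snd p)) has_derivative (\<lambda>h. \<eta>' (snd p) * snd h)) (at p within A)"
      using d\<eta> [of "snd p", unfolded has_field_derivative_def]
      by (rule has_derivative_compose [OF has_derivative_snd [OF has_derivative_ident]])
    show ?thesis
      unfolding g_def
      by (rule has_derivative_eq_rhs [OF has_derivative_mult [OF 1 2]])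
        (auto simp: g'_def fun_eq_iff inner_prod_def algebra_simps)
  qed
  have test: "C1_test (t + 2) g g'"
    unfolding C1_test_def Let_def
  proof (intro conjI ballI exI)
    show "(g has_derivative blinfun_apply (g' p)) (at p within UNIV \<times> {0..<t + 2})" for p
      by (rule dg)
    have "continuous_on UNIV g'"
      unfolding g'_def \<eta>_def \<eta>'_def
      by (intro bounded_linear.continuous_on [OF bounded_linear_blinfun_inner_left] continuous_intros
          continuous_on_compose2 [OF cG] continuous_on_compose2 [OF c\<psi>]) auto
    then show "continuous_on (UNIV \<times> {0..<t + 2}) g'"
      by (rule continuous_on_subset) simp
    show "compact (K \<times> {0..t + 1})" using K by (intro compact_Times) auto
    show "K \<times> {0..t + 1} \<subseteq> UNIV \<times> {0..<t + 2}" by auto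
    show "g p = 0" if "p \<in> UNIV \<times> {0..<t + 2} - K \<times> {0..t + 1}" for p
      using that K(2) \<eta>0 by (cases p) (auto simp: g_def)
  qed
  have tr: "transport lw lx lv \<phi> (\<mu> r) g' r = (\<lambda>z. F r z \<bullet> G z)" if "r \<le> t" for r
    using \<eta>1 [OF that] by (auto simp: fun_eq_iff transport_def g'_def F_def inner_prod_def inner_commute)
  have *: "set_integrable lborel {0..u} (\<lambda>r. LINT z|\<mu> r. F r z \<bullet> G z) \<and>
      (LINT z|\<mu> u. \<psi> z) - (LINT z|\<mu>0. \<psi> z) = (LINT r:{0..u}|lborel. (LINT z|\<mu> r. F r z \<bullet> G z))"
    if u: "0 \<le> u" "u \<le> t" for u
  proof -
    have "set_integrable lborel {0..u} (\<lambda>s. LINT z|\<mu> s. transport lw lx lv \<phi> (\<mu> s) g' s z) \<and>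
        (LINT z|\<mu> u. g (z, u)) - (LINT z|\<mu>0. g (z, 0)) =
          (LINT s:{0..u}|lborel. (LINT z|\<mu> s. transport lw lx lv \<phi> (\<mu> s) g' s z))"
      using sol_on [of t] test u by (auto simp: measure_valued_solution_def)
    moreover have "set_integrable lborel {0..u} (\<lambda>s. LINT z|\<mu> s. transport lw lx lv \<phi> (\<mu> s) g' s z)
        \<longleftrightarrow> set_integrable lborel {0..u} (\<lambda>r. LINT z|\<mu> r. F r z \<bullet> G z)"
      using u by (intro set_integrable_cong) (auto simp: tr)
    moreover have "(LINT s:{0..u}|lborel. (LINT z|\<mu> s. transport lw lx lv \<phi> (\<mu> s) g' s z))
        = (LINT r:{0..u}|lborel. (LINT z|\<mu> r. F r z \<bullet> G z))"
      using u by (intro set_lebesgue_integral_cong) (auto simp: tr)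
    ultimately show ?thesis using u \<eta>1(1) st by (simp add: g_def)
  qed
  have i: "set_integrable lborel {0..t} (\<lambda>r. LINT z|\<mu> r. F r z \<bullet> G z)" using * [of t] st by auto
  show i': "set_integrable lborel {s..t} (\<lambda>r. LINT z|\<mu> r. F r z \<bullet> G z)"
    using i by (rule set_integrable_subset) (use st in auto)
  have "(LINT r:{0..t}|lborel. (LINT z|\<mu> r. F r z \<bullet> G z)) =
     (LINT r:{0..s}|lborel. (LINT z|\<mu> r. F r z \<bullet> G z)) + (LINT r:{s..t}|lborel. (LINT z|\<mu> r. F r z \<bullet> G z))"
  proof -
    have "{0..t} = {0..s} \<union> {s..t}" using st by auto
    moreover have "AE r in lborel. \<not> (r \<in> {0..s} \<and> r \<in> {s..t})"
      using AE_lborel_singleton [of s] by eventually_elim auto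
    ultimately show ?thesis
      using st i' * [of s] by (simp add: set_integral_Un_AE)
  qed
  then show "(LINT z|\<mu> t. \<psi> z) - (LINT z|\<mu> s. \<psi> z) = (LINT r:{s..t}|lborel. (LINT z|\<mu> r. F r z \<bullet> G z))"
    using * [of s] * [of t] st by simp
qed

end

section \<open>Elementary bounds for integrals over an interval\<close>

lemma set_lebesgue_integral_le:
  fixes f :: "real \<Rightarrow> real"
  assumes "set_integrable lborel {s..t} f" "s \<le> t" "\<And>r. s \<le> r \<Longrightarrow> r \<le> t \<Longrightarrow> f r \<le> D"
  shows "(LINT r:{s..t}|lborel. f r) \<le> D * (t - s)"
proof -
  have "(LINT r:{s..t}|lborel. f r) \<le> (LINT r:{s..t}|lborel. D)"
    using assms by (intro set_integral_mono) (auto simp: set_integrable_def)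
  also have "\<dots> = D * (t - s)"
    using assms(2) by (simp add: set_lebesgue_integral_def mult.commute)
  finally show ?thesis .
qed

lemma abs_set_lebesgue_integral_le:
  fixes f :: "real \<Rightarrow> real"
  assumes f: "set_integrable lborel {s..t} f" and "s \<le> t" "\<And>r. s \<le> r \<Longrightarrow> r \<le> t \<Longrightarrow> \<bar>f r\<bar> \<le> D"
  shows "\<bar>LINT r:{s..t}|lborel. f r\<bar> \<le> D * (t - s)"
proof -
  have 1: "(LINT r:{s..t}|lborel. f r) \<le> D * (t - s)"
    using assms by (intro set_lebesgue_integral_le) (auto simp: abs_le_iff)
  have "set_integrable lborel {s..t} (\<lambda>r. - f r)"
    using f by (simp add: set_integrable_def)
  then have "(LINT r:{s..t}|lborel. - f r) \<le> D * (t - s)"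
    using assms by (intro set_lebesgue_integral_le) (auto simp: abs_le_iff)
  then show ?thesis using 1 by (simp add: set_lebesgue_integral_def abs_le_iff)
qed

lemma norm_fst_le_norm: "norm (fst z) \<le> norm z"
  and norm_snd_le_norm: "norm (snd z) \<le> norm z"
  by (cases z; simp add: norm_fst_le norm_snd_le)+

section \<open>Growth of the interaction kernel and of the force, and test functions of polynomial
  growth\<close>

context herding
begin

lemma \<phi>m_pos: "\<phi>m > 0" and \<phi>M_pos: "\<phi>M > 0"
  and \<phi>_ge: "\<phi>m \<le> \<phi> r" and \<phi>_le: "\<phi> r \<le> \<phi>M"
  using rate unfolding communication_rate_def by blast+

lemma \<phi>_pos: "\<phi> r > 0"
  using \<phi>m_pos \<phi>_ge [of r] by linarith

lemma continuous_on_\<phi> [continuous_intros]: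
  "continuous_on S f \<Longrightarrow> continuous_on S (\<lambda>x. \<phi> (f x))"
proof -
  have "continuous_on UNIV \<phi>"
    using rate lipschitz_on_continuous_on unfolding communication_rate_def by blast
  then show "continuous_on S f \<Longrightarrow> continuous_on S (\<lambda>x. \<phi> (f x))"
    by (rule continuous_on_compose2) auto
qed

definition kernel :: "'d phase \<Rightarrow> 'd phase \<Rightarrow> real ^ 'd" where
  "kernel z w = lw *\<^sub>R (fst w - fst z)
     + (lx * \<phi> (norm (fst z - fst w))) *\<^sub>R (fst w - fst z)
     + (lv * \<phi> (norm (fst z - fst w))) *\<^sub>R (snd w - snd z)"

definition c0 :: real where
  "c0 = lw + lx * \<phi>M + lv * \<phi>M"

lemma c0_pos: "c0 > 0"
  using lw lx lv \<phi>M_pos by (simp add: c0_def add_pos_pos)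

lemma herding_force_kernel:
  "herding_force lw lx lv \<phi> (fst z) (snd z) \<nu> = (LINT w|\<nu>. kernel z w)"
  by (simp add: herding_force_def kernel_def)

lemma norm_kernel_le: "norm (kernel z w) \<le> c0 * (norm z + norm w)"
proof -
  have "norm (kernel z w) \<le> lw * norm (fst w - fst z)
      + (lx * \<phi> (norm (fst z - fst w))) * norm (fst w - fst z)
      + (lv * \<phi> (norm (fst z - fst w))) * norm (snd w - snd z)"
    unfolding kernel_def using lw lx lv \<phi>_pos
    by (intro norm_triangle_le add_mono) (auto simp: abs_mult less_imp_le)
  also have "\<dots> \<le> lw * (norm z + norm w) + (lx * \<phi>M) * (norm z + norm w) + (lv * \<phi>M) * (norm z + norm w)"
  proof -
    have "norm (fst w - fst z) \<le> norm z + norm w"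
      using norm_triangle_ineq4 [of "fst w" "fst z"] norm_fst_le_norm [of w] norm_fst_le_norm [of z] by linarith
    moreover have "norm (snd w - snd z) \<le> norm z + norm w"
      using norm_triangle_ineq4 [of "snd w" "snd z"] norm_snd_le_norm [of w] norm_snd_le_norm [of z] by linarith
    ultimately show ?thesis
      using lw lx lv \<phi>_pos \<phi>M_pos \<phi>_le
      by (intro add_mono mult_mono mult_nonneg_nonneg mult_left_mono) (auto simp: less_imp_le)
  qed
  finally show ?thesis by (simp add: c0_def algebra_simps)
qed

lemma kernel_antisym: "kernel w z = - kernel z w"
  by (simp add: kernel_def norm_minus_commute [of "fst w"] scaleR_diff_right)

lemma continuous_on_kernel: "continuous_on UNIV (\<lambda>p. kernel (fst p) (snd p))"
  unfolding kernel_def by (intro continuous_intros)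

lemma sets_pair_mu: "r \<ge> 0 \<Longrightarrow> sets (\<mu> r \<Otimes>\<^sub>M \<mu> r) = sets borel"
  using sets_pair_measure_cong [OF sets_mu sets_mu, of r r] by (metis borel_prod)

lemma measurable_pair_mu:
  "r \<ge> 0 \<Longrightarrow> continuous_on UNIV f \<Longrightarrow> f \<in> borel_measurable (\<mu> r \<Otimes>\<^sub>M \<mu> r)"
  using measurable_cong_sets [OF sets_pair_mu refl] borel_measurable_continuous_onI by blast

text \<open>Weighted with \<open>bracket\<close> instead of \<open>norm\<close>: the weight is
  differentiable everywhere, and being at least 1 it makes the first moment control the mass as
  well.\<close>

definition moment :: "real \<Rightarrow> real" where
  "moment r = (LINT z|\<mu> r. bracket z)"

definition mass :: "real \<Rightarrow> real" where
  "mass r = measure (\<mu> r) UNIV"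

lemma integral_const_mu: "r \<ge> 0 \<Longrightarrow> (LINT z|\<mu> r. c) = c * mass r"
  using space_mu [of r] by (simp add: mass_def)

lemma integrable_const_mu: "r \<ge> 0 \<Longrightarrow> integrable (\<mu> r) (\<lambda>z. c::real)"
  using finite_measure.integrable_const [OF finite_mu] by blast

lemma mass_nonneg: "mass r \<ge> 0"
  by (simp add: mass_def)

lemma integrable_norm_mu: "r \<ge> 0 \<Longrightarrow> integrable (\<mu> r) norm"
  using integrable_norm [OF integrable_id] by simp

lemma integrable_bracket: "r \<ge> 0 \<Longrightarrow> integrable (\<mu> r) bracket"
proof (rule Bochner_Integration.integrable_bound)
  assume r: "r \<ge> 0"
  show "integrable (\<mu> r) (\<lambda>z. 1 + norm z)"
    using r by (intro Bochner_Integration.integrable_add integrable_const_mu integrable_norm_mu)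
  show "bracket \<in> borel_measurable (\<mu> r)"
    by (intro measurable_mu r continuous_on_bracket continuous_on_id)
  show "AE z in \<mu> r. norm (bracket z) \<le> norm (1 + norm z)"
    by (intro AE_I2) (simp add: abs_of_pos bracket_pos bracket_le)
qed

lemma mass_le_moment: "r \<ge> 0 \<Longrightarrow> mass r \<le> moment r"
proof -
  assume r: "r \<ge> 0"
  have "(LINT z|\<mu> r. 1) \<le> moment r"
    unfolding moment_def
    by (intro integral_mono integrable_const_mu integrable_bracket r bracket_ge_1)
  then show ?thesis using integral_const_mu [OF r, of 1] by simp
qed

lemma integrable_kernel: "r \<ge> 0 \<Longrightarrow> integrable (\<mu> r) (kernel z)"
proof (rule Bochner_Integration.integrable_bound)
  show "r \<ge> 0 \<Longrightarrow> integrable (\<mu> r) (\<lambda>w. c0 * norm z + c0 * norm w)"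
    by (intro Bochner_Integration.integrable_add integrable_mult_right integrable_const_mu integrable_norm_mu)
  show "r \<ge> 0 \<Longrightarrow> kernel z \<in> borel_measurable (\<mu> r)"
    by (intro measurable_mu continuous_on_compose2 [OF continuous_on_kernel, of _ "\<lambda>w. (z, w)", simplified]
        continuous_intros)
  show "r \<ge> 0 \<Longrightarrow> AE w in \<mu> r. norm (kernel z w) \<le> norm (c0 * norm z + c0 * norm w)"
    using norm_kernel_le [of z] c0_pos by (auto simp: algebra_simps)
qed

lemma norm_force_le:
  assumes "r \<ge> 0"
  shows "norm (LINT w|\<mu> r. kernel z w) \<le> c0 * (mass r * norm z + moment r)"
proof -
  have "norm (LINT w|\<mu> r. kernel z w) \<le> (LINT w|\<mu> r. norm (kernel z w))"
    by (rule integral_norm_bound)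
  also have "\<dots> \<le> (LINT w|\<mu> r. c0 * norm z + c0 * bracket w)"
  proof (rule integral_mono)
    show "integrable (\<mu> r) (\<lambda>w. c0 * norm z + c0 * bracket w)"
      using assms
      by (intro Bochner_Integration.integrable_add integrable_mult_right integrable_const_mu integrable_bracket)
    show "integrable (\<mu> r) (\<lambda>w. norm (kernel z w))"
      using integrable_kernel assms by blast
    show "norm (kernel z w) \<le> c0 * norm z + c0 * bracket w" for w
      using norm_kernel_le [of z w] mult_left_mono [OF norm_le_bracket [of w], of c0] c0_pos
      unfolding distrib_left by linarith
  qed
  also have "\<dots> = c0 * (mass r * norm z + moment r)"
    using assms integrable_bracket [OF assms] integrable_const_mu [OF assms]
    by (simp add: mass_def space_mu moment_def algebra_simps)
  finally show ?thesis .
qed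

text \<open>The field grows linearly, with coefficients that depend on the solution only through its
  mass and first moment at that time.\<close>

lemma norm_F_le:
  assumes "r \<ge> 0"
  shows "norm (F r z) \<le> (1 + c0 * mass r) * bracket z + c0 * moment r"
proof -
  have "norm (F r z) \<le> norm (snd z) + norm (LINT w|\<mu> r. kernel z w)"
    unfolding F_def herding_force_kernel by (rule norm_Pair_le)
  also have "\<dots> \<le> bracket z + c0 * (mass r * bracket z + moment r)"
    using norm_force_le [OF assms, of z] norm_snd_le_norm [of z] norm_le_bracket [of z]
      mult_left_mono [OF norm_le_bracket [of z], of "c0 * mass r"] c0_pos mass_nonneg [of r]
    by (simp add: algebra_simps)
  finally show ?thesis by (simp add: algebra_simps)
qed

lemma measurable_force: "r \<ge> 0 \<Longrightarrow> (\<lambda>z. LINT w|\<mu> r. kernel z w) \<in> borel_measurable (\<mu> r)"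
proof -
  assume r: "r \<ge> 0"
  interpret finite_measure "\<mu> r" by (rule finite_mu [OF r])
  show ?thesis
    using measurable_pair_mu [OF r continuous_on_kernel]
    by (intro borel_measurable_lebesgue_integral) (simp add: case_prod_beta')
qed

lemma measurable_F: "r \<ge> 0 \<Longrightarrow> F r \<in> borel_measurable (\<mu> r)"
  unfolding F_def [abs_def] herding_force_kernel
  by (intro borel_measurable_Pair measurable_force measurable_mu continuous_intros)

text \<open>Exhaustion by \<open>cutoff\<close>. The cut-off gradients \<open>Gn\<close> inherit the
  growth of \<open>G\<close> uniformly in \<open>k\<close> and converge to it pointwise. Dominated
  convergence is applied in phase space with a multiple of \<open>bracket z ^ Suc j\<close>, and
  then in time with a constant obtained from \<open>K\<close>.\<close>

lemma weak_growth:
  assumes G: "\<And>z. GDERIV \<psi> z :> G z" and cG: "continuous_on UNIV G"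
    and bd: "\<And>z. \<bar>\<psi> z\<bar> \<le> c * bracket z ^ Suc j" "\<And>z. norm (G z) \<le> c * bracket z ^ j"
    and mom: "\<And>r. s \<le> r \<Longrightarrow> r \<le> t \<Longrightarrow> integrable (\<mu> r) (\<lambda>z. bracket z ^ Suc j)"
      "\<And>r. s \<le> r \<Longrightarrow> r \<le> t \<Longrightarrow> (LINT z|\<mu> r. bracket z ^ Suc j) \<le> K"
    and st: "0 \<le> s" "s \<le> t"
  shows "set_integrable lborel {s..t} (\<lambda>r. LINT z|\<mu> r. F r z \<bullet> G z)"
    and "(LINT z|\<mu> t. \<psi> z) - (LINT z|\<mu> s. \<psi> z) = (LINT r:{s..t}|lborel. (LINT z|\<mu> r. F r z \<bullet> G z))"
proof -
  define \<psi>n where "\<psi>n = (\<lambda>k z. cutoff (real (Suc k)) z * \<psi> z)"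
  define Gn where "Gn = (\<lambda>k z. cutoff (real (Suc k)) z *\<^sub>R G z + \<psi> z *\<^sub>R cutoff_grad (real (Suc k)) z)"
  \<comment> \<open>The linear growth constant of \<open>F\<close>, with both mass and first moment
    estimated by \<open>K\<close>; this is legitimate because \<open>bracket\<close> is at most its
    power \<open>Suc j\<close>.\<close>
  define L where "L = 1 + 2 * c0 * K"
  have c\<psi>: "continuous_on UNIV \<psi>"
    using G unfolding gderiv_def
    by (meson continuous_at_imp_continuous_on has_derivative_continuous)
  have "0 \<le> c * bracket (0::'d phase) ^ j" using bd(2) [of 0] norm_ge_zero order_trans by blast
  then have c: "c \<ge> 0"
    using zero_less_power [OF bracket_pos, of "0::'d phase" j] by (simp add: zero_le_mult_iff)
  have moment: "moment r \<le> K" if "s \<le> r" "r \<le> t" for r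
  proof -
    have "moment r \<le> (LINT z|\<mu> r. bracket z ^ Suc j)"
      unfolding moment_def
    proof (rule integral_mono)
      show "bracket z \<le> bracket z ^ Suc j" for z :: "'d phase"
        using bracket_ge_1 [of z] self_le_power by blast
    qed (use integrable_bracket mom that st in auto)
    then show ?thesis using mom(2) [OF that] by linarith
  qed
  have mass: "mass r \<le> K" if "s \<le> r" "r \<le> t" for r
    using moment [OF that] mass_le_moment [of r] that st by linarith
  have K: "K \<ge> 0" using mass [of s] mass_nonneg [of s] st by simp
  have L: "L \<ge> 0" using K c0_pos by (simp add: L_def)
  have FL: "norm (F r z) \<le> L * bracket z" if "s \<le> r" "r \<le> t" for r z
  proof -
    have "norm (F r z) \<le> (1 + c0 * mass r) * bracket z + c0 * moment r"
      using that st by (intro norm_F_le) auto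
    also have "\<dots> \<le> (1 + c0 * K) * bracket z + c0 * K * bracket z"
    proof (rule add_mono [OF mult_right_mono])
      show "1 + c0 * mass r \<le> 1 + c0 * K" "bracket z \<ge> 0"
        using mass [OF that] c0_pos bracket_pos [of z] by (auto simp: less_imp_le)
      have "c0 * moment r \<le> c0 * K * 1" using moment [OF that] c0_pos by simp
      also have "\<dots> \<le> c0 * K * bracket z" using c0_pos K bracket_ge_1 [of z] by (intro mult_left_mono) auto
      finally show "c0 * moment r \<le> c0 * K * bracket z" .
    qed
    finally show ?thesis by (simp add: L_def algebra_simps)
  qed
  have dGn: "GDERIV (\<psi>n k) z :> Gn k z" for k z
    unfolding \<psi>n_def Gn_def by (intro GDERIV_mult GDERIV_cutoff G)
  have cGn: "continuous_on UNIV (Gn k)" for k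
    unfolding Gn_def by (intro continuous_intros cG c\<psi>)
  \<comment> \<open>The constant 9 is 1 from the cut-off \<open>G\<close> plus 8 from the gradient
    of the cutoff, whose decay compensates the extra power of \<open>bracket\<close> in
    \<psi>.\<close>
  have Gn: "norm (Gn k z) \<le> 9 * c * bracket z ^ j" for k z
  proof -
    have "norm (Gn k z) \<le> cutoff (real (Suc k)) z * norm (G z) + \<bar>\<psi> z\<bar> * norm (cutoff_grad (real (Suc k)) z)"
      unfolding Gn_def by (rule norm_triangle_le) (simp add: cutoff_nonneg)
    also have "\<dots> \<le> 1 * (c * bracket z ^ j) + c * bracket z ^ Suc j * norm (cutoff_grad (real (Suc k)) z)"
      using bd cutoff_nonneg cutoff_le_1 c
      by (intro add_mono mult_mono mult_nonneg_nonneg zero_le_power less_imp_le [OF bracket_pos]) auto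
    also have "c * bracket z ^ Suc j * norm (cutoff_grad (real (Suc k)) z)
        = c * bracket z ^ j * (norm (cutoff_grad (real (Suc k)) z) * bracket z)" by simp
    also have "\<dots> \<le> c * bracket z ^ j * 8"
      using c bracket_pos [of z] by (intro mult_left_mono norm_cutoff_grad_le) auto
    finally show ?thesis by simp
  qed
  define h where "h = (\<lambda>r. LINT z|\<mu> r. F r z \<bullet> G z)"
  define hn where "hn = (\<lambda>k r. LINT z|\<mu> r. F r z \<bullet> Gn k z)"
  have dom: "\<bar>F r z \<bullet> Gn k z\<bar> \<le> 9 * L * c * bracket z ^ Suc j" if "s \<le> r" "r \<le> t" for r z k
  proof -
    have "\<bar>F r z \<bullet> Gn k z\<bar> \<le> norm (F r z) * norm (Gn k z)" by (rule Cauchy_Schwarz_ineq2)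
    also have "\<dots> \<le> (L * bracket z) * (9 * c * bracket z ^ j)"
      using FL [OF that] Gn L bracket_pos [of z] by (intro mult_mono) (auto simp: less_imp_le)
    finally show ?thesis by (simp add: algebra_simps)
  qed
  have hn_lim: "(\<lambda>k. hn k r) \<longlonglongrightarrow> h r" if r: "s \<le> r" "r \<le> t" for r
    unfolding hn_def h_def
  proof (rule integral_dominated_convergence [where w = "\<lambda>z. 9 * L * c * bracket z ^ Suc j"])
    have "r \<ge> 0" using r st by simp
    then show "(\<lambda>z. F r z \<bullet> G z) \<in> borel_measurable (\<mu> r)"
      "\<And>k. (\<lambda>z. F r z \<bullet> Gn k z) \<in> borel_measurable (\<mu> r)"
      by (intro borel_measurable_inner measurable_F measurable_mu cG cGn; assumption)+
    show "integrable (\<mu> r) (\<lambda>z. 9 * L * c * bracket z ^ Suc j)"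
      using mom(1) [OF r] by (rule integrable_mult_right)
    show "AE z in \<mu> r. (\<lambda>k. F r z \<bullet> Gn k z) \<longlonglongrightarrow> F r z \<bullet> G z"
    proof (rule AE_I2)
      fix z
      have "(\<lambda>k. F r z \<bullet> Gn k z) \<longlonglongrightarrow> F r z \<bullet> (1 *\<^sub>R G z + \<psi> z *\<^sub>R 0)"
        unfolding Gn_def by (intro tendsto_intros cutoff_tendsto cutoff_grad_tendsto)
      then show "(\<lambda>k. F r z \<bullet> Gn k z) \<longlonglongrightarrow> F r z \<bullet> G z" by simp
    qed
  qed (use dom [OF r] in auto)
  have hn_le: "\<bar>hn k r\<bar> \<le> 9 * L * c * K" if r: "s \<le> r" "r \<le> t" for k r
  proof -
    have "\<bar>hn k r\<bar> \<le> (LINT z|\<mu> r. \<bar>F r z \<bullet> Gn k z\<bar>)"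
      unfolding hn_def by (rule integral_abs_bound)
    also have "\<dots> \<le> (LINT z|\<mu> r. 9 * L * c * bracket z ^ Suc j)"
      using dom [OF r] by (intro integral_mono' integrable_mult_right mom(1) [OF r] order_trans [OF abs_ge_zero dom [OF r]])
    also have "\<dots> \<le> 9 * L * c * K"
      using mom [OF r] L c by (simp del: power_Suc add: mult_left_mono)
    finally show ?thesis .
  qed
  have weak: "set_integrable lborel {s..t} (hn k)"
    "(LINT z|\<mu> t. \<psi>n k z) - (LINT z|\<mu> s. \<psi>n k z) = (LINT r:{s..t}|lborel. hn k r)" for k
    unfolding hn_def
    using weak_compact_support [OF dGn cGn compact_cball [of 0 "real (Suc k)"] _ st]
    by (auto simp: \<psi>n_def cutoff_eq_0)
  have lim: "(\<lambda>k. indicator {s..t} r *\<^sub>R hn k r) \<longlonglongrightarrow> indicator {s..t} r *\<^sub>R h r" for r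
    using hn_lim [of r] by (cases "r \<in> {s..t}") auto
  have meas: "(\<lambda>r. indicator {s..t} r *\<^sub>R hn k r) \<in> borel_measurable lborel" for k
    using weak(1) [of k] by (auto simp: set_integrable_def)
  have int: "integrable lborel (\<lambda>r. indicator {s..t} r *\<^sub>R h r)"
    and lim_int: "(\<lambda>k. LINT r|lborel. indicator {s..t} r *\<^sub>R hn k r) \<longlonglongrightarrow> (LINT r|lborel. indicator {s..t} r *\<^sub>R h r)"
  proof -
    have w: "integrable lborel (\<lambda>r. indicator {s..t} r *\<^sub>R (9 * L * c * K))"
      by (intro integrable_scaleR_left impI integrable_real_indicator) (auto simp: emeasure_lborel_Icc_eq)
    have le: "AE r in lborel. norm (indicator {s..t} r *\<^sub>R hn k r) \<le> indicator {s..t} r *\<^sub>R (9 * L * c * K)" for k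
      using hn_le [of _ k] by (auto intro!: AE_I2 split: split_indicator)
    \<comment> \<open>Measurability in time of the limit is not given beforehand; it is inherited
      from the \<open>hn k\<close>, which are integrable by the weak formulation.\<close>
    have h: "(\<lambda>r. indicator {s..t} r *\<^sub>R h r) \<in> borel_measurable lborel"
      using borel_measurable_LIMSEQ_metric [OF meas lim] .
    show "integrable lborel (\<lambda>r. indicator {s..t} r *\<^sub>R h r)"
      using integrable_dominated_convergence [OF h meas w AE_I2 [OF lim] le] .
    show "(\<lambda>k. LINT r|lborel. indicator {s..t} r *\<^sub>R hn k r) \<longlonglongrightarrow> (LINT r|lborel. indicator {s..t} r *\<^sub>R h r)"
      using integral_dominated_convergence [OF h meas w AE_I2 [OF lim] le] .
  qed
  show "set_integrable lborel {s..t} (\<lambda>r. LINT z|\<mu> r. F r z \<bullet> G z)"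
    using int by (simp add: set_integrable_def h_def)
  have \<psi>_lim: "(\<lambda>k. LINT z|\<mu> r. \<psi>n k z) \<longlonglongrightarrow> (LINT z|\<mu> r. \<psi> z)" if r: "s \<le> r" "r \<le> t" for r
  proof (rule integral_dominated_convergence [where w = "\<lambda>z. c * bracket z ^ Suc j"])
    have "r \<ge> 0" using r st by simp
    then show "\<psi> \<in> borel_measurable (\<mu> r)" "\<And>k. \<psi>n k \<in> borel_measurable (\<mu> r)"
      unfolding \<psi>n_def by (intro measurable_mu c\<psi> continuous_intros; assumption)+
    show "integrable (\<mu> r) (\<lambda>z. c * bracket z ^ Suc j)"
      using mom(1) [OF r] by (rule integrable_mult_right)
    show "AE z in \<mu> r. (\<lambda>k. \<psi>n k z) \<longlonglongrightarrow> \<psi> z"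
    proof (rule AE_I2)
      fix z
      have "(\<lambda>k. \<psi>n k z) \<longlonglongrightarrow> 1 * \<psi> z"
        unfolding \<psi>n_def by (intro tendsto_intros cutoff_tendsto)
      then show "(\<lambda>k. \<psi>n k z) \<longlonglongrightarrow> \<psi> z" by simp
    qed
    show "AE z in \<mu> r. norm (\<psi>n k z) \<le> c * bracket z ^ Suc j" for k
    proof (rule AE_I2)
      fix z
      have "norm (\<psi>n k z) \<le> 1 * (c * bracket z ^ Suc j)"
        unfolding \<psi>n_def norm_mult using bd(1) [of z] cutoff_nonneg [of "real (Suc k)" z] cutoff_le_1 [of "real (Suc k)" z]
        by (intro mult_mono) auto
      then show "norm (\<psi>n k z) \<le> c * bracket z ^ Suc j" by simp
    qed
  qed
  have "(\<lambda>k. LINT r|lborel. indicator {s..t} r *\<^sub>R hn k r) \<longlonglongrightarrow> (LINT z|\<mu> t. \<psi> z) - (LINT z|\<mu> s. \<psi> z)"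
    using tendsto_diff [OF \<psi>_lim [of t] \<psi>_lim [of s]] st weak(2) by (simp add: set_lebesgue_integral_def)
  then show "(LINT z|\<mu> t. \<psi> z) - (LINT z|\<mu> s. \<psi> z) = (LINT r:{s..t}|lborel. (LINT z|\<mu> r. F r z \<bullet> G z))"
    using LIMSEQ_unique [OF _ lim_int] by (simp add: set_lebesgue_integral_def h_def)
qed

end

section \<open>Local boundedness of the first moment\<close>

text \<open>A two-sided Gronwall inequality: over a time \<open>1 / (2 * L)\<close> the function at most doubles, both
  forwards and backwards.\<close>

lemma doubling_bound:
  fixes f :: "real \<Rightarrow> real"
  assumes S: "is_interval S" and f0: "\<And>r. r \<in> S \<Longrightarrow> 0 \<le> f r" and bd: "\<And>r. r \<in> S \<Longrightarrow> f r \<le> M"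
    and step: "\<And>s t K. s \<in> S \<Longrightarrow> t \<in> S \<Longrightarrow> s \<le> t \<Longrightarrow> (\<And>r. s \<le> r \<Longrightarrow> r \<le> t \<Longrightarrow> f r \<le> K) \<Longrightarrow>
        \<bar>f t - f s\<bar> \<le> L * K * (t - s)"
    and L: "L > 0" and uw: "u \<in> S" "w \<in> S" "2 * L * \<bar>u - w\<bar> \<le> real n"
  shows "f u \<le> 2 ^ n * f w"
proof -
  have one: "f u \<le> 2 * f w" if uw: "u \<in> S" "w \<in> S" "2 * L * \<bar>u - w\<bar> \<le> 1" for u w
  proof -
    define J where "J = {min u w..max u w}"
    \<comment> \<open>The bound \<open>M\<close> serves only to make this supremum finite. On an
      interval this short a step costs at most \<open>D / 2\<close>, so the supremum absorbs half of
      itself and \<open>D\<close> is at most \<open>2 * f w\<close>.\<close>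
    define D where "D = (SUP r\<in>J. f r)"
    have JS: "J \<subseteq> S"
    proof
      fix r assume "r \<in> J"
      then have "min u w \<le> r" "r \<le> max u w" by (auto simp: J_def)
      moreover have "min u w \<in> S" "max u w \<in> S" using uw by (auto simp: min_def max_def)
      ultimately show "r \<in> S" using S mem_is_interval_1_I by blast
    qed
    have le_D: "f r \<le> D" if "r \<in> J" for r
      unfolding D_def by (rule cSUP_upper [OF that]) (use bd JS in \<open>auto intro!: bdd_aboveI2 [of _ _ M]\<close>)
    have w: "w \<in> J" and u: "u \<in> J" by (auto simp: J_def)
    have D0: "D \<ge> 0" using le_D [OF w] f0 uw by force
    have "f r \<le> f w + D / 2" if r: "r \<in> J" for r
    proof -
      have "\<bar>f (max r w) - f (min r w)\<bar> \<le> L * D * (max r w - min r w)"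
      proof (rule step)
        show "min r w \<in> S" "max r w \<in> S" using r w JS by (auto simp: min_def max_def)
        show "f q \<le> D" if "min r w \<le> q" "q \<le> max r w" for q
          using that r by (intro le_D) (auto simp: J_def)
      qed auto
      then have "\<bar>f r - f w\<bar> \<le> L * D * \<bar>r - w\<bar>"
        by (cases "r \<le> w") (auto simp: abs_minus_commute)
      also have "\<dots> \<le> L * D * \<bar>u - w\<bar>"
        using r L D0 by (intro mult_left_mono) (auto simp: J_def)
      also have "\<dots> = (2 * L * \<bar>u - w\<bar>) * (D / 2)" by simp
      also have "\<dots> \<le> 1 * (D / 2)" using uw D0 by (intro mult_right_mono) auto
      finally show ?thesis by linarith
    qed
    then have "D \<le> f w + D / 2"
      unfolding D_def using w by (intro cSUP_least) auto
    then show ?thesis using le_D [OF u] by linarith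
  qed
  show ?thesis
    using uw
  proof (induction n arbitrary: u)
    case 0
    then have "\<bar>u - w\<bar> \<le> 0" using L by (simp add: mult_le_0_iff)
    then show ?case by simp
  next
    case (Suc n)
    \<comment> \<open>The point \<open>v\<close> divides the way from \<open>w\<close> to
      \<open>u\<close> in the ratio \<open>n\<close> to 1: the induction hypothesis covers the first
      part, a single doubling the rest.\<close>
    define p where "p = real n / real (Suc n)"
    define v where "v = (1 - p) * w + p * u"
    have p: "0 \<le> p" "p \<le> 1" "1 - p = 1 / real (Suc n)" by (auto simp: p_def field_simps)
    have "v \<in> closed_segment w u"
      unfolding in_segment using p by (intro exI [of _ p]) (simp add: v_def)
    then have "w \<le> v \<and> v \<le> u \<or> u \<le> v \<and> v \<le> w"
      by (simp add: closed_segment_eq_real_ivl split: if_splits)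
    then have v: "v \<in> S"
      using Suc.prems S mem_is_interval_1_I by blast
    have "v - w = p * (u - w)" by (simp add: v_def algebra_simps)
    then have "2 * L * \<bar>v - w\<bar> = 2 * L * \<bar>u - w\<bar> * p"
      using p by (simp add: abs_mult)
    also have "\<dots> \<le> real (Suc n) * p"
      using Suc.prems(3) p by (intro mult_right_mono) auto
    also have "\<dots> = real n" by (simp add: p_def)
    finally have 1: "f v \<le> 2 ^ n * f w"
      using Suc.IH [OF v] Suc.prems by simp
    have "u - v = (1 - p) * (u - w)" by (simp add: v_def algebra_simps)
    then have "2 * L * \<bar>u - v\<bar> = 2 * L * \<bar>u - w\<bar> * (1 / real (Suc n))"
      unfolding p(3) by (simp add: abs_mult)
    also have "\<dots> \<le> real (Suc n) * (1 / real (Suc n))"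
      using Suc.prems(3) by (intro mult_right_mono) auto
    finally have "f u \<le> 2 * f v" using one v Suc.prems by simp
    with 1 show ?case by simp
  qed
qed

section \<open>Growth of the first moment while it is bounded\<close>

context herding
begin

text \<open>The constant 1 is the test function; its gradient vanishes, and the bounded first moment
  makes it admissible with \<open>j = 0\<close>.\<close>

lemma mass_const:
  assumes st: "0 \<le> s" "s \<le> t" and K: "\<And>r. s \<le> r \<Longrightarrow> r \<le> t \<Longrightarrow> moment r \<le> K"
  shows "mass s = mass t"
proof -
  have "(LINT z|\<mu> t. 1) - (LINT z|\<mu> s. 1) = (LINT r:{s..t}|lborel. (LINT z|\<mu> r. F r z \<bullet> 0))"
    using st K bracket_ge_1 integrable_bracket
    by (intro weak_growth(2) [where c = 1 and j = 0 and K = K] GDERIV_const)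
      (auto simp: moment_def)
  then show ?thesis using st integral_const_mu [of s 1] integral_const_mu [of t 1] by simp
qed

text \<open>The test function is \<open>bracket\<close>, whose gradient has norm at most 1. Half of
  the \<open>c0\<close> term stems from the linear growth of the force in \<open>z\<close> and half
  from the moment inside the force. The rate contains the mass but not \<open>K\<close>, which
  enters linearly, as the Gronwall argument requires.\<close>

lemma moment_diff:
  assumes st: "0 \<le> s" "s \<le> t" and K: "\<And>r. s \<le> r \<Longrightarrow> r \<le> t \<Longrightarrow> moment r \<le> K"
    and M: "\<And>r. s \<le> r \<Longrightarrow> r \<le> t \<Longrightarrow> mass r = M"
  shows "\<bar>moment t - moment s\<bar> \<le> (1 + 2 * c0 * M) * K * (t - s)"
proof -
  define G where "G = (\<lambda>z::'d phase. (1 / bracket z) *\<^sub>R z)"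
  have cG: "continuous_on UNIV G"
    unfolding G_def by (intro continuous_intros) (simp add: less_imp_neq [OF bracket_pos, symmetric])
  have G: "norm (G z) \<le> 1" for z
    using norm_le_bracket [of z] bracket_pos [of z] by (simp add: G_def)
  have M0: "M \<ge> 0" using M [of s] mass_nonneg [of s] st by simp
  have dG: "GDERIV bracket z :> G z" for z
    unfolding G_def by (rule GDERIV_bracket)
  have bd: "\<bar>bracket z\<bar> \<le> 1 * bracket z ^ Suc 0" "norm (G z) \<le> 1 * bracket z ^ 0" for z :: "'d phase"
    using G [of z] by (simp_all add: abs_of_pos bracket_pos)
  have mom: "integrable (\<mu> r) (\<lambda>z. bracket z ^ Suc 0)" "(LINT z|\<mu> r. bracket z ^ Suc 0) \<le> K"
    if "s \<le> r" "r \<le> t" for r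
    using K [OF that] integrable_bracket [of r] that st by (simp_all add: moment_def)
  have weak: "set_integrable lborel {s..t} (\<lambda>r. LINT z|\<mu> r. F r z \<bullet> G z)"
    by (rule weak_growth(1) [OF dG cG bd mom st])
  have eq: "moment t - moment s = (LINT r:{s..t}|lborel. (LINT z|\<mu> r. F r z \<bullet> G z))"
    unfolding moment_def by (rule weak_growth(2) [OF dG cG bd mom st])
  have "\<bar>LINT z|\<mu> r. F r z \<bullet> G z\<bar> \<le> (1 + 2 * c0 * M) * K" if r: "s \<le> r" "r \<le> t" for r
  proof -
    have r0: "r \<ge> 0" using r st by simp
    have "\<bar>LINT z|\<mu> r. F r z \<bullet> G z\<bar> \<le> (LINT z|\<mu> r. \<bar>F r z \<bullet> G z\<bar>)"
      by (rule integral_abs_bound)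
    also have "\<dots> \<le> (LINT z|\<mu> r. (1 + c0 * M) * bracket z + c0 * moment r)"
    proof (rule integral_mono')
      show "integrable (\<mu> r) (\<lambda>z. (1 + c0 * M) * bracket z + c0 * moment r)"
        using r0 by (intro Bochner_Integration.integrable_add integrable_mult_right integrable_bracket integrable_const_mu)
      show *: "\<bar>F r z \<bullet> G z\<bar> \<le> (1 + c0 * M) * bracket z + c0 * moment r" for z
      proof -
        have "\<bar>F r z \<bullet> G z\<bar> \<le> norm (F r z) * norm (G z)" by (rule Cauchy_Schwarz_ineq2)
        also have "\<dots> \<le> norm (F r z) * 1" by (rule mult_left_mono [OF G norm_ge_zero])
        finally show ?thesis using norm_F_le [OF r0, of z] M [OF r] by simp
      qed
      show "0 \<le> (1 + c0 * M) * bracket z + c0 * moment r" for z :: "'d phase"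
        using * [of z] abs_ge_zero order_trans by blast
    qed
    also have "\<dots> = (1 + 2 * c0 * M) * moment r"
      using integrable_bracket [OF r0] integrable_const_mu [OF r0] integral_const_mu [OF r0, of "c0 * moment r"] M [OF r]
      by (simp add: moment_def algebra_simps)
    also have "\<dots> \<le> (1 + 2 * c0 * M) * K"
      using K [OF r] c0_pos M0 by (intro mult_left_mono) auto
    finally show ?thesis .
  qed
  then show ?thesis
    unfolding eq by (intro abs_set_lebesgue_integral_le weak st)
qed

text \<open>Boundedness on the segment is needed as a fact, but \<open>K\<close> does not enter the
  factor: only the mass and the length do. A closed segment is used because \<open>u\<close> may lie
  on either side of \<open>w\<close>.\<close>

lemma moment_comparable:
  assumes K: "\<And>r. r \<in> closed_segment u w \<Longrightarrow> 0 \<le> r \<and> moment r \<le> K"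
  shows "mass u = mass w"
    and "2 * (1 + 2 * c0 * mass w) * \<bar>u - w\<bar> \<le> real n \<Longrightarrow> moment u \<le> 2 ^ n * moment w"
proof -
  define S where "S = closed_segment u w"
  have S: "is_interval S" by (simp add: S_def is_interval_1 closed_segment_eq_real_ivl)
  have K': "0 \<le> r \<and> moment r \<le> K" if "s \<in> S" "t \<in> S" "s \<le> r" "r \<le> t" for s t r
    using K [of r] mem_is_interval_1_I [OF S that] unfolding S_def by blast
  have uw: "u \<in> S" "w \<in> S" by (auto simp: S_def)
  have mass_le: "mass s = mass t" if "s \<in> S" "t \<in> S" "s \<le> t" for s t
    using K' [OF that(1,2)] that(3) by (intro mass_const [of s t K]) auto
  have mass: "mass s = mass t" if "s \<in> S" "t \<in> S" for s t
    using mass_le [OF that] mass_le [OF that(2,1), symmetric] linear [of s t] by blast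
  show "mass u = mass w" using mass uw by blast
  assume n: "2 * (1 + 2 * c0 * mass w) * \<bar>u - w\<bar> \<le> real n"
  show "moment u \<le> 2 ^ n * moment w"
  proof (rule doubling_bound [OF S _ _ _ _ uw n])
    show "moment r \<ge> 0" "moment r \<le> K" if "r \<in> S" for r
      using mass_le_moment [of r] mass_nonneg [of r] K [of r] that by (auto simp: S_def)
    show "1 + 2 * c0 * mass w > 0"
      using c0_pos mass_nonneg [of w] by (simp add: add_pos_nonneg)
    show "\<bar>moment t - moment s\<bar> \<le> (1 + 2 * c0 * mass w) * K * (t - s)"
      if st: "s \<in> S" "t \<in> S" "s \<le> t" "\<And>r. s \<le> r \<Longrightarrow> r \<le> t \<Longrightarrow> moment r \<le> K" for s t K
    proof (rule moment_diff)
      show "0 \<le> s" using K' [OF st(1,2), of s] st by simp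
      show "mass r = mass w" if "s \<le> r" "r \<le> t" for r
        using mass [OF mem_is_interval_1_I [OF S st(1,2) that] uw(2)] .
    qed (use st in auto)
  qed
qed

section \<open>Times near which the first moment could be unbounded\<close>

definition bounded_near :: "real \<Rightarrow> bool" where
  "bounded_near t \<longleftrightarrow> (\<exists>e>0. \<exists>K. \<forall>r\<ge>0. \<bar>r - t\<bar> < e \<longrightarrow> moment r \<le> K)"

lemma open_bounded_near: "open {t. bounded_near t}"
  unfolding open_dist
proof (intro ballI)
  fix t assume "t \<in> {t. bounded_near t}"
  then obtain e K where e: "e > 0" "\<And>r. r \<ge> 0 \<Longrightarrow> \<bar>r - t\<bar> < e \<Longrightarrow> moment r \<le> K"
    by (auto simp: bounded_near_def)
  show "\<exists>e>0. \<forall>y. dist y t < e \<longrightarrow> y \<in> {t. bounded_near t}"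
  proof (intro exI [of _ "e / 2"] conjI allI impI)
    fix y assume y: "dist y t < e / 2"
    have *: "moment r \<le> K" if "r \<ge> 0" "\<bar>r - y\<bar> < e / 2" for r
    proof (rule e(2))
      have "\<bar>r - t\<bar> \<le> \<bar>r - y\<bar> + \<bar>y - t\<bar>" by arith
      then show "\<bar>r - t\<bar> < e" using that y by (simp add: dist_real_def)
    qed fact
    then show "y \<in> {t. bounded_near t}"
      unfolding bounded_near_def mem_Collect_eq using e(1)
      by (intro exI [of _ "e / 2"] conjI exI [of _ K] allI impI *) auto
  qed (use e in auto)
qed

text \<open>Compactness of the interval, in the form of bisection: bounds on adjacent intervals
  combine, and every point has a neighbourhood with a bound.\<close>

lemma bounded_near_imp_bounded:
  assumes "\<And>t. a \<le> t \<Longrightarrow> t \<le> b \<Longrightarrow> bounded_near t"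
  shows "\<exists>K. \<forall>r\<ge>0. a \<le> r \<longrightarrow> r \<le> b \<longrightarrow> moment r \<le> K"
proof (cases "a \<le> b")
  case True
  then show ?thesis
  proof (rule Bolzano [where P = "\<lambda>a b. \<exists>K. \<forall>r\<ge>0. a \<le> r \<longrightarrow> r \<le> b \<longrightarrow> moment r \<le> K"])
    fix p q s
    assume "\<exists>K. \<forall>r\<ge>0. p \<le> r \<longrightarrow> r \<le> q \<longrightarrow> moment r \<le> K" "\<exists>K. \<forall>r\<ge>0. q \<le> r \<longrightarrow> r \<le> s \<longrightarrow> moment r \<le> K"
    then obtain K K' where "\<forall>r\<ge>0. p \<le> r \<longrightarrow> r \<le> q \<longrightarrow> moment r \<le> K" "\<forall>r\<ge>0. q \<le> r \<longrightarrow> r \<le> s \<longrightarrow> moment r \<le> K'"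
      by blast
    then show "\<exists>K. \<forall>r\<ge>0. p \<le> r \<longrightarrow> r \<le> s \<longrightarrow> moment r \<le> K"
      by (intro exI [of _ "max K K'"]) (metis le_max_iff_disj linear)
  next
    fix t assume "a \<le> t" "t \<le> b"
    then obtain e K where e: "e > 0" "\<And>r. r \<ge> 0 \<Longrightarrow> \<bar>r - t\<bar> < e \<Longrightarrow> moment r \<le> K"
      using assms unfolding bounded_near_def by metis
    then show "\<exists>d>0. \<forall>p q. p \<le> t \<and> t \<le> q \<and> q - p < d \<longrightarrow> (\<exists>K. \<forall>r\<ge>0. p \<le> r \<longrightarrow> r \<le> q \<longrightarrow> moment r \<le> K)"
      by (intro exI [of _ e] conjI allI impI exI [of _ K]) auto
  qed
next
  case False
  then show ?thesis by auto
qed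

text \<open>Lower semicontinuity in disguise. The moment is the supremum of its truncations
  \<open>p k\<close>, which are continuous in time because the truncated weight lies in
  \<open>C_0\<close>; the sublevel set is therefore an intersection of closed sets.\<close>

lemma closed_moment_le: "closed {t. 0 \<le> t \<and> moment t \<le> c}"
proof -
  define p where "p = (\<lambda>k t. LINT z|\<mu> t. cutoff (real (Suc k)) z * bracket z)"
  have cont: "continuous_on UNIV (\<lambda>z::'d phase. cutoff (real (Suc k)) z * bracket z)" for k
    by (intro continuous_intros)
  have pc: "continuous_on {0..} (p k)" for k
    unfolding p_def
    by (intro continuous_pairing compact_support_in_C_0 [where R = "real (Suc k)"] cont)
      (simp add: cutoff_eq_0)
  have le: "norm (cutoff (real (Suc k)) z * bracket z) \<le> bracket z" for k and z :: "'d phase"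
    using cutoff_nonneg [of "real (Suc k)" z] cutoff_le_1 [of "real (Suc k)" z] bracket_pos [of z]
    by (simp add: abs_mult)
  have "moment t \<le> c \<longleftrightarrow> (\<forall>k. p k t \<le> c)" if t: "t \<ge> 0" for t
  proof
    assume "moment t \<le> c"
    moreover have "p k t \<le> moment t" for k
      unfolding p_def moment_def
      using le [of k] integrable_bracket [OF t]
      by (intro integral_mono') (simp_all add: abs_le_iff less_imp_le bracket_pos)
    ultimately show "\<forall>k. p k t \<le> c" using order_trans by blast
  next
    assume *: "\<forall>k. p k t \<le> c"
    have "(\<lambda>k. p k t) \<longlonglongrightarrow> moment t"
      unfolding p_def moment_def
    proof (rule integral_dominated_convergence [OF measurable_mu measurable_mu integrable_bracket])
      show "AE z in \<mu> t. (\<lambda>k. cutoff (real (Suc k)) z * bracket z) \<longlonglongrightarrow> bracket z"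
        using tendsto_mult [OF cutoff_tendsto tendsto_const] by (intro AE_I2) force
    qed (use t cont le in \<open>auto intro!: continuous_on_bracket continuous_on_id\<close>)
    then show "moment t \<le> c" using * LIMSEQ_le_const2 by blast
  qed
  then have "{t. 0 \<le> t \<and> moment t \<le> c} = (\<Inter>k. {t \<in> {0..}. p k t \<le> c})"
    by auto
  also have "closed \<dots>"
    by (intro closed_INT ballI continuous_on_closed_Collect_le pc continuous_on_const closed_atLeast)
  finally show ?thesis .
qed

text \<open>The definition of a solution does not exclude a first moment that is finite at every time but
  not locally bounded. Since the moment is lower semicontinuous, Baire's theorem gives an interval on
  which it is bounded at all bad times. On a gap between bad times the moment is comparable with
  its value at the adjacent bad time, so it is bounded on the whole interval, which therefore
  contains no bad time.\<close>

lemma bounded_near: "bounded_near t"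
proof (cases "t \<ge> 0")
  case False
  then show ?thesis
    unfolding bounded_near_def by (intro exI [of _ "- t"] conjI exI [of _ 0]) auto
next
  case True
  show ?thesis
  proof (rule ccontr)
    assume nb: "\<not> bounded_near t"
    define B where "B = {t. 0 \<le> t \<and> \<not> bounded_near t}"
    have clB: "closed B"
    proof -
      have "B = {0..} \<inter> - {t. bounded_near t}" by (auto simp: B_def)
      then show ?thesis
        using open_bounded_near by (auto intro!: closed_Int simp: closed_Compl)
    qed
    \<comment> \<open>Otherwise the complements in \<open>B\<close> of the sublevel sets would all
      be relatively open and dense. Their intersection is empty, since each moment is a real number
      and lies below some \<open>n\<close>, but \<open>B\<close> contains \<open>t\<close>.\<close>
    have "\<exists>n::nat. \<exists>s\<in>B. \<exists>e>0. B \<inter> ball s e \<subseteq> {r. 0 \<le> r \<and> moment r \<le> real n}"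
    proof (rule ccontr)
      assume no: "\<not> ?thesis"
      have dense: "B \<subseteq> closure (\<Inter> (range (\<lambda>n::nat. B - {r. 0 \<le> r \<and> moment r \<le> real n})))"
      proof (rule Baire [OF clB])
        fix U assume "U \<in> range (\<lambda>n::nat. B - {r. 0 \<le> r \<and> moment r \<le> real n})"
        then obtain n :: nat where U: "U = B - {r. 0 \<le> r \<and> moment r \<le> real n}" by blast
        have "U = B \<inter> - {r. 0 \<le> r \<and> moment r \<le> real n}" using U by blast
        then have "openin (top_of_set B) U"
          using closed_moment_le by (auto intro!: openin_open_Int simp: open_Compl)
        moreover have "B \<subseteq> closure U"
          unfolding closure_approachable subset_iff
        proof (intro allI impI)
          fix s e assume "s \<in> B" "(e::real) > 0"
          then obtain r where "r \<in> B \<inter> ball s e" "r \<notin> {r. 0 \<le> r \<and> moment r \<le> real n}"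
            using no by blast
          then show "\<exists>y\<in>U. dist y s < e" using U by (auto simp: dist_commute)
        qed
        ultimately show "openin (top_of_set B) U \<and> B \<subseteq> closure U" by blast
      qed auto
      have empty: "\<Inter> (range (\<lambda>n::nat. B - {r. 0 \<le> r \<and> moment r \<le> real n})) = {}"
      proof (rule equals0I)
        fix r assume r: "r \<in> \<Inter> (range (\<lambda>n::nat. B - {r. 0 \<le> r \<and> moment r \<le> real n}))"
        obtain n :: nat where "moment r \<le> real n" using real_arch_simple by blast
        moreover have "r \<in> B - {r. 0 \<le> r \<and> moment r \<le> real n}" using r by blast
        ultimately show False by (auto simp: B_def)
      qed
      have "t \<in> B" using nb True by (simp add: B_def)
      then show False using dense unfolding empty by simp
    qed
    then obtain n :: nat and s e where s: "s \<in> B" and e: "e > 0"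
      and n: "\<And>r. r \<in> B \<Longrightarrow> \<bar>r - s\<bar> < e \<Longrightarrow> moment r \<le> real n"
      by (auto simp: subset_iff dist_real_def abs_minus_commute)
    \<comment> \<open>Chosen before \<open>u\<close>, from \<open>n\<close> and \<open>e\<close>
      only, so that the final bound is uniform over the neighbourhood of \<open>s\<close>.\<close>
    obtain N :: nat where N: "2 * (1 + 2 * c0 * real n) * e \<le> real N"
      using real_arch_simple by blast
    have s0: "s \<ge> 0" using s by (simp add: B_def)
    have "moment u \<le> 2 ^ N * real n" if u: "u \<ge> 0" "\<bar>u - s\<bar> < e" for u
    proof -
      \<comment> \<open>The bad time closest to \<open>u\<close> on the way back to
        \<open>s\<close>; it exists because \<open>B\<close> is closed and contains
        \<open>s\<close>. If \<open>u\<close> itself is bad, then \<open>a = u\<close>.\<close>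
      obtain a where a: "a \<in> B" "a \<in> closed_segment s u"
        and amin: "\<And>b. b \<in> B \<Longrightarrow> b \<in> closed_segment s u \<Longrightarrow> dist u a \<le> dist u b"
        using distance_attains_inf [of "B \<inter> closed_segment s u" u] clB s closed_segment
        by (metis IntD1 IntD2 IntI closed_Int empty_iff ends_in_segment(1))
      have ae: "\<bar>a - s\<bar> < e" "\<bar>a - u\<bar> < e" and a0: "a \<ge> 0"
        using a u s0 by (auto simp: closed_segment_eq_real_ivl split: if_splits)
      have an: "moment a \<le> real n" using n a ae by blast
      have near: "bounded_near w" if w: "w \<in> closed_segment a u" "w \<noteq> a" for w
      proof (rule ccontr)
        assume "\<not> bounded_near w"
        moreover have "w \<ge> 0" using w a0 u by (auto simp: closed_segment_eq_real_ivl split: if_splits)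
        ultimately have "w \<in> B" by (simp add: B_def)
        moreover have "w \<in> closed_segment s u"
          using w a(2) by (auto simp: closed_segment_eq_real_ivl split: if_splits)
        ultimately have "dist u a \<le> dist u w" by (rule amin)
        then show False
          using w by (auto simp: closed_segment_eq_real_ivl dist_real_def split: if_splits)
      qed
      obtain N' :: nat where N': "2 * (1 + 2 * c0 * mass u) * \<bar>a - u\<bar> \<le> real N'"
        using real_arch_simple by blast
      \<comment> \<open>The first comparison goes from \<open>u\<close> towards \<open>a\<close>
        without reaching it, where compactness supplies a bound. Its constant depends on
        \<open>u\<close>, but not on how close \<open>w\<close> is to \<open>a\<close>; together
        with the bound at \<open>a\<close> it gives boundedness on the closed gap.\<close>
      have le_u: "moment w \<le> 2 ^ N' * moment u" if w: "w \<in> closed_segment a u" "w \<noteq> a" for w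
      proof -
        have *: "\<And>r. min w u \<le> r \<Longrightarrow> r \<le> max w u \<Longrightarrow> bounded_near r"
          using w by (intro near) (auto simp: closed_segment_eq_real_ivl split: if_splits)
        from bounded_near_imp_bounded [OF *] obtain K where
          "\<And>r. r \<ge> 0 \<Longrightarrow> min w u \<le> r \<Longrightarrow> r \<le> max w u \<Longrightarrow> moment r \<le> K" by blast
        then have K: "0 \<le> r \<and> moment r \<le> K" if "r \<in> closed_segment w u" for r
          using that w a0 u by (auto simp: closed_segment_eq_real_ivl split: if_splits)
        have "2 * (1 + 2 * c0 * mass u) * \<bar>w - u\<bar> \<le> 2 * (1 + 2 * c0 * mass u) * \<bar>a - u\<bar>"
          using w c0_pos mass_nonneg [of u]
          by (intro mult_left_mono) (auto simp: closed_segment_eq_real_ivl split: if_splits)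
        then show ?thesis using moment_comparable(2) [OF K] N' by (meson order_trans)
      qed
      have K: "0 \<le> r \<and> moment r \<le> max (real n) (2 ^ N' * moment u)" if "r \<in> closed_segment a u" for r
        using le_u [OF that] an a0 u that
        by (cases "r = a") (auto simp: closed_segment_eq_real_ivl split: if_splits)
      have K': "0 \<le> r \<and> moment r \<le> max (real n) (2 ^ N' * moment u)" if "r \<in> closed_segment u a" for r
        using K that by (simp add: closed_segment_commute)
      \<comment> \<open>The second comparison runs over the whole gap, now known to have bounded
        moment, and starts from the bad time \<open>a\<close>. Its factor is controlled by the mass
        at \<open>a\<close>, hence by \<open>n\<close>, and no longer depends on
        \<open>u\<close>.\<close>
      have "mass a \<le> real n" using mass_le_moment [OF a0] an by linarith
      then have "2 * (1 + 2 * c0 * mass a) * \<bar>u - a\<bar> \<le> 2 * (1 + 2 * c0 * real n) * e"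
        using ae c0_pos mass_nonneg [of a] by (intro mult_mono) (auto simp: abs_minus_commute)
      then have "moment u \<le> 2 ^ N * moment a"
        using moment_comparable(2) [OF K'] N by (meson order_trans)
      also have "\<dots> \<le> 2 ^ N * real n" using an by simp
      finally show ?thesis .
    qed
    then have "bounded_near s" using e by (auto simp: bounded_near_def)
    then show False using s by (simp add: B_def)
  qed
qed

lemma moment_bounded: "\<exists>K. \<forall>r. 0 \<le> r \<longrightarrow> r \<le> t \<longrightarrow> moment r \<le> K"
  using bounded_near_imp_bounded [of 0 t] bounded_near by auto

lemma mass_eq_1: "t \<ge> 0 \<Longrightarrow> mass t = 1"
  using moment_bounded [of t] mass_const [of 0 t] mass_0 mu_0 by (auto simp: mass_def)

end

section \<open>The second moment\<close>

text \<open>A bounded regularisation \<open>\<psi>\<close> of \<open>(bracket z)\<^sup>2\<close> with \<open>norm (\<nabla>\<psi>) * bracket \<le> 2 * \<psi>\<close>, which makes the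
  Gronwall constant independent of \<open>\<epsilon>\<close>.\<close>

definition damped_sq :: "real \<Rightarrow> 'a::real_inner \<Rightarrow> real" where
  "damped_sq \<epsilon> z = (bracket z)\<^sup>2 / (1 + \<epsilon> * (bracket z)\<^sup>2)"

definition damped_sq_grad :: "real \<Rightarrow> 'a::real_inner \<Rightarrow> 'a" where
  "damped_sq_grad \<epsilon> z = (2 / (1 + \<epsilon> * (bracket z)\<^sup>2)\<^sup>2) *\<^sub>R z"

context
  fixes \<epsilon> :: real assumes \<epsilon>: "\<epsilon> > 0"
begin

lemma damped_denom: "1 + \<epsilon> * (bracket z)\<^sup>2 > 1"
  using \<epsilon> bracket_pos [of z] by simp

lemma damped_sq_pos: "damped_sq \<epsilon> z > 0"
  using damped_denom [of z] bracket_pos [of z] by (simp add: damped_sq_def)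

lemma damped_sq_le: "damped_sq \<epsilon> z \<le> (bracket z)\<^sup>2"
  using damped_denom [of z] bracket_pos [of z]
    mult_left_mono [of 1 "1 + \<epsilon> * (bracket z)\<^sup>2" "(bracket z)\<^sup>2"]
  by (simp add: damped_sq_def divide_le_eq)

lemma damped_sq_le_const: "damped_sq \<epsilon> z \<le> 1 / \<epsilon>"
  using damped_denom [of z] \<epsilon> by (simp add: damped_sq_def field_simps)

lemma GDERIV_damped_sq: "GDERIV (damped_sq \<epsilon>) z :> damped_sq_grad \<epsilon> z"
proof -
  define D where "D = 1 + \<epsilon> * (1 + z \<bullet> z)"
  have D: "D > 1" using damped_denom [of z] by (simp add: D_def bracket_sq)
  have "DERIV (\<lambda>u. (1 + u) / (1 + \<epsilon> * (1 + u))) (z \<bullet> z) :> 1 / D\<^sup>2"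
  proof (rule DERIV_cong [OF DERIV_divide])
    show "DERIV (\<lambda>u. 1 + u) (z \<bullet> z) :> 1" by (auto intro!: derivative_eq_intros)
    show "DERIV (\<lambda>u. 1 + \<epsilon> * (1 + u)) (z \<bullet> z) :> \<epsilon>" by (auto intro!: derivative_eq_intros)
    show "1 + \<epsilon> * (1 + z \<bullet> z) \<noteq> 0" using D by (simp add: D_def)
    show "(1 * (1 + \<epsilon> * (1 + z \<bullet> z)) - (1 + z \<bullet> z) * \<epsilon>) / ((1 + \<epsilon> * (1 + z \<bullet> z)) * (1 + \<epsilon> * (1 + z \<bullet> z))) = 1 / D\<^sup>2"
      by (simp add: D_def power2_eq_square algebra_simps)
  qed
  from GDERIV_DERIV_compose [OF GDERIV_inner_self this] show ?thesis
    by (simp add: damped_sq_def [abs_def] damped_sq_grad_def bracket_sq D_def)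
qed

lemma continuous_on_damped_sq_grad: "continuous_on S (damped_sq_grad \<epsilon>)"
  unfolding damped_sq_grad_def
  by (intro continuous_intros) (metis damped_denom less_numeral_extra(1) not_less_iff_gr_or_eq order_less_trans zero_eq_power2)

lemma norm_damped_sq_grad_le: "norm (damped_sq_grad \<epsilon> z) * bracket z \<le> 2 * damped_sq \<epsilon> z"
proof -
  define D where "D = 1 + \<epsilon> * (bracket z)\<^sup>2"
  have D: "D > 1" unfolding D_def by (rule damped_denom)
  have "norm (damped_sq_grad \<epsilon> z) * bracket z = 2 * (norm z * bracket z) / D\<^sup>2"
    using D by (simp add: damped_sq_grad_def D_def)
  also have "\<dots> \<le> 2 * (bracket z)\<^sup>2 / D"
  proof (rule frac_le)
    show "2 * (norm z * bracket z) \<le> 2 * (bracket z)\<^sup>2"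
      using norm_le_bracket [of z] bracket_pos [of z] by (simp add: power2_eq_square)
    show "D \<le> D\<^sup>2" using D by (simp add: self_le_power)
  qed (use D in auto)
  finally show ?thesis by (simp add: damped_sq_def D_def)
qed

end

context herding
begin

lemma integrable_bracket_sq_0: "integrable (\<mu> 0) (\<lambda>z. (bracket z)\<^sup>2)"
proof -
  obtain K where K: "compact K" "emeasure (\<mu> 0) (- K) = 0"
    using compact_0 mu_0 by (auto simp: compactly_supported_def)
  obtain b where b: "\<And>z. z \<in> K \<Longrightarrow> norm z \<le> b"
    using compact_imp_bounded [OF K(1)] by (auto simp: bounded_iff)
  interpret finite_measure "\<mu> 0" by (rule finite_mu) simp
  show ?thesis
  proof (rule integrable_const_bound)
    have "- K \<in> sets (\<mu> 0)"
      using K(1) sets_mu [of 0] by (simp add: borel_closed borel_comp compact_imp_closed)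
    then have "AE z in \<mu> 0. z \<in> K"
      using K(2) by (intro AE_I [where N = "- K"]) auto
    then show "AE z in \<mu> 0. norm ((bracket z)\<^sup>2) \<le> 1 + b\<^sup>2"
    proof eventually_elim
      fix z assume "z \<in> K"
      then have "(norm z)\<^sup>2 \<le> b\<^sup>2" using b by (intro power_mono) auto
      then show "norm ((bracket z)\<^sup>2) \<le> 1 + b\<^sup>2" by (simp add: bracket_sq power2_norm_eq_inner)
    qed
    show "(\<lambda>z. (bracket z)\<^sup>2) \<in> borel_measurable (\<mu> 0)"
      by (intro measurable_mu continuous_intros) simp
  qed
qed

text \<open>For fixed \<epsilon> the test function and its gradient are bounded, so bounded first
  moments already admit it. The first moment also bounds the field by a multiple of
  \<open>bracket\<close>, and the gradient inequality closes the Gronwall estimate with a factor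
  free of \<epsilon>.\<close>

lemma damped_moment_le:
  assumes \<epsilon>: "\<epsilon> > 0" and t: "t \<ge> 0" and K: "\<And>r. 0 \<le> r \<Longrightarrow> r \<le> t \<Longrightarrow> moment r \<le> K"
    and n: "4 * (1 + 2 * c0 * K) * t \<le> real n"
  shows "(LINT z|\<mu> t. damped_sq \<epsilon> z) \<le> 2 ^ n * (LINT z|\<mu> 0. damped_sq \<epsilon> z)"
proof -
  define L where "L = 1 + 2 * c0 * K"
  have K1: "K \<ge> 1" using K [of 0] mass_le_moment [of 0] mass_eq_1 [of 0] t by simp
  have L: "L > 0" using c0_pos K1 by (simp add: L_def add_pos_nonneg)
  have cont: "continuous_on UNIV (damped_sq \<epsilon> :: 'd phase \<Rightarrow> real)"
    using GDERIV_damped_sq [OF \<epsilon>] unfolding gderiv_def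
    by (meson continuous_at_imp_continuous_on has_derivative_continuous)
  have int: "integrable (\<mu> r) (damped_sq \<epsilon>)" if "r \<ge> 0" for r
  proof (rule Bochner_Integration.integrable_bound [OF integrable_const_mu [OF that, of "1 / \<epsilon>"] measurable_mu [OF that cont]])
    show "AE z in \<mu> r. norm (damped_sq \<epsilon> z) \<le> norm (1 / \<epsilon>)"
      using \<epsilon> by (intro AE_I2) (simp add: abs_of_pos damped_sq_pos damped_sq_le_const)
  qed
  have FL: "norm (F r z) \<le> L * bracket z" if r: "0 \<le> r" "r \<le> t" for r z
  proof -
    have "norm (F r z) \<le> (1 + c0) * bracket z + c0 * moment r"
      using norm_F_le [OF r(1), of z] mass_eq_1 [OF r(1)] by simp
    also have "\<dots> \<le> (1 + c0 * K) * bracket z + c0 * K * bracket z"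
    proof (rule add_mono [OF mult_right_mono])
      show "1 + c0 \<le> 1 + c0 * K" "bracket z \<ge> 0"
        using K1 c0_pos bracket_pos [of z] by (auto simp: less_imp_le)
      have "c0 * moment r \<le> c0 * K * 1" using K [OF r] c0_pos by simp
      also have "\<dots> \<le> c0 * K * bracket z" using c0_pos K1 bracket_ge_1 [of z] by (intro mult_left_mono) auto
      finally show "c0 * moment r \<le> c0 * K * bracket z" .
    qed
    finally show ?thesis by (simp add: L_def algebra_simps)
  qed
  show ?thesis
  \<comment> \<open>The gradient inequality doubles the rate to \<open>2 * L\<close>; the bound
    \<open>1 / \<epsilon>\<close> only secures finiteness and does not survive into the
    conclusion.\<close>
  proof (rule doubling_bound [where f = "\<lambda>r. LINT z|\<mu> r. damped_sq \<epsilon> z" and S = "{0..t}" and L = "2 * L" and M = "1 / \<epsilon>"])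
    fix r assume r: "r \<in> {0..t}"
    show "0 \<le> (LINT z|\<mu> r. damped_sq \<epsilon> z)"
      by (intro integral_nonneg_AE AE_I2 less_imp_le damped_sq_pos \<epsilon>)
    have "(LINT z|\<mu> r. damped_sq \<epsilon> z) \<le> (LINT z|\<mu> r. 1 / \<epsilon>)"
      using r by (intro integral_mono int integrable_const_mu damped_sq_le_const \<epsilon>) auto
    then show "(LINT z|\<mu> r. damped_sq \<epsilon> z) \<le> 1 / \<epsilon>"
      using r integral_const_mu [of r "1 / \<epsilon>"] mass_eq_1 [of r] \<epsilon> by simp
  next
    fix p q D
    assume pq: "p \<in> {0..t}" "q \<in> {0..t}" "p \<le> q"
      and D: "\<And>r. p \<le> r \<Longrightarrow> r \<le> q \<Longrightarrow> (LINT z|\<mu> r. damped_sq \<epsilon> z) \<le> D"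
    have pq': "0 \<le> p" using pq by simp
    have g: "norm (damped_sq_grad \<epsilon> z) \<le> 2 * damped_sq \<epsilon> z" for z :: "'d phase"
    proof -
      have "norm (damped_sq_grad \<epsilon> z) * 1 \<le> norm (damped_sq_grad \<epsilon> z) * bracket z"
        by (intro mult_left_mono bracket_ge_1) simp
      then show ?thesis using norm_damped_sq_grad_le [OF \<epsilon>, of z] by linarith
    qed
    have bd: "\<bar>damped_sq \<epsilon> z\<bar> \<le> 2 / \<epsilon> * bracket z ^ Suc 0" "norm (damped_sq_grad \<epsilon> z) \<le> 2 / \<epsilon> * bracket z ^ 0"
      for z :: "'d phase"
    proof -
      have "2 / \<epsilon> * 1 \<le> 2 / \<epsilon> * bracket z" using \<epsilon> bracket_ge_1 [of z] by (intro mult_left_mono) auto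
      then show "\<bar>damped_sq \<epsilon> z\<bar> \<le> 2 / \<epsilon> * bracket z ^ Suc 0"
        using damped_sq_pos [OF \<epsilon>, of z] damped_sq_le_const [OF \<epsilon>, of z] by simp
      show "norm (damped_sq_grad \<epsilon> z) \<le> 2 / \<epsilon> * bracket z ^ 0"
        using g [of z] damped_sq_le_const [OF \<epsilon>, of z] by simp
    qed
    have mom: "integrable (\<mu> r) (\<lambda>z. bracket z ^ Suc 0)" "(LINT z|\<mu> r. bracket z ^ Suc 0) \<le> K"
      if "p \<le> r" "r \<le> q" for r
      using K [of r] integrable_bracket [of r] that pq by (simp_all add: moment_def)
    note wg = weak_growth [OF GDERIV_damped_sq [OF \<epsilon>] continuous_on_damped_sq_grad [OF \<epsilon>] bd mom pq' pq(3)]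
    have "\<bar>LINT z|\<mu> r. F r z \<bullet> damped_sq_grad \<epsilon> z\<bar> \<le> 2 * L * D" if r: "p \<le> r" "r \<le> q" for r
    proof -
      have r0: "0 \<le> r" "r \<le> t" using r pq by auto
      have "\<bar>LINT z|\<mu> r. F r z \<bullet> damped_sq_grad \<epsilon> z\<bar> \<le> (LINT z|\<mu> r. \<bar>F r z \<bullet> damped_sq_grad \<epsilon> z\<bar>)"
        by (rule integral_abs_bound)
      also have "\<dots> \<le> (LINT z|\<mu> r. 2 * L * damped_sq \<epsilon> z)"
      proof (rule integral_mono')
        show "integrable (\<mu> r) (\<lambda>z. 2 * L * damped_sq \<epsilon> z)"
          by (intro integrable_mult_right int r0)
        fix z :: "'d phase"
        have "\<bar>F r z \<bullet> damped_sq_grad \<epsilon> z\<bar> \<le> norm (F r z) * norm (damped_sq_grad \<epsilon> z)"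
          by (rule Cauchy_Schwarz_ineq2)
        also have "\<dots> \<le> (L * bracket z) * norm (damped_sq_grad \<epsilon> z)"
          by (intro mult_right_mono FL r0 norm_ge_zero)
        also have "\<dots> = L * (norm (damped_sq_grad \<epsilon> z) * bracket z)" by simp
        also have "\<dots> \<le> L * (2 * damped_sq \<epsilon> z)"
          using L by (intro mult_left_mono norm_damped_sq_grad_le \<epsilon>) auto
        finally show "\<bar>F r z \<bullet> damped_sq_grad \<epsilon> z\<bar> \<le> 2 * L * damped_sq \<epsilon> z" by simp
        show "0 \<le> 2 * L * damped_sq \<epsilon> z"
          using L damped_sq_pos [OF \<epsilon>, of z] by simp
      qed
      also have "\<dots> = 2 * L * (LINT z|\<mu> r. damped_sq \<epsilon> z)" by simp
      also have "\<dots> \<le> 2 * L * D" using L D [OF r] by simp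
      finally show ?thesis .
    qed
    then have "\<bar>LINT r:{p..q}|lborel. (LINT z|\<mu> r. F r z \<bullet> damped_sq_grad \<epsilon> z)\<bar> \<le> 2 * L * D * (q - p)"
      by (intro abs_set_lebesgue_integral_le wg(1) pq)
    then show "\<bar>(LINT z|\<mu> q. damped_sq \<epsilon> z) - (LINT z|\<mu> p. damped_sq \<epsilon> z)\<bar> \<le> 2 * L * D * (q - p)"
      using wg(2) by presburger
  next
    show "2 * (2 * L) * \<bar>t - 0\<bar> \<le> real n" using n t by (simp add: L_def)
  qed (use t L in \<open>auto simp: is_interval_cc\<close>)
qed

text \<open>Monotone convergence as \<epsilon> decreases to 0 along \<open>1 / real (Suc k)\<close>.
  The initial second moment is finite by compact support, and the doubling factor is common to all
  \<epsilon> and all times up to \<open>t\<close>.\<close>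

lemma second_moment_bounded:
  assumes t: "t \<ge> 0"
  shows "\<exists>M. \<forall>r. 0 \<le> r \<longrightarrow> r \<le> t \<longrightarrow> integrable (\<mu> r) (\<lambda>z. (bracket z)\<^sup>2) \<and> (LINT z|\<mu> r. (bracket z)\<^sup>2) \<le> M"
proof -
  obtain K where K: "\<And>r. 0 \<le> r \<Longrightarrow> r \<le> t \<Longrightarrow> moment r \<le> K" using moment_bounded by blast
  obtain n :: nat where n: "4 * (1 + 2 * c0 * K) * t \<le> real n" using real_arch_simple by blast
  have K1: "K \<ge> 1" using K [of 0] mass_le_moment [of 0] mass_eq_1 [of 0] t by simp
  define M where "M = 2 ^ n * (LINT z|\<mu> 0. (bracket z)\<^sup>2)"
  have "integrable (\<mu> r) (\<lambda>z. (bracket z)\<^sup>2) \<and> (LINT z|\<mu> r. (bracket z)\<^sup>2) \<le> M" if r: "0 \<le> r" "r \<le> t" for r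
  proof -
    define e where "e = (\<lambda>k. 1 / real (Suc k))"
    have e: "e k > 0" for k by (simp add: e_def)
    define f where "f = (\<lambda>k z. damped_sq (e k) (z :: 'd phase))"
    have cont: "continuous_on UNIV (f k)" for k
      using GDERIV_damped_sq [OF e] unfolding gderiv_def f_def
      by (meson continuous_at_imp_continuous_on has_derivative_continuous)
    have int: "integrable (\<mu> r) (f k)" for k
    proof (rule Bochner_Integration.integrable_bound [OF integrable_const_mu [OF r(1), of "1 / e k"] measurable_mu [OF r(1) cont]])
      show "AE z in \<mu> r. norm (f k z) \<le> norm (1 / e k)"
        unfolding f_def using e [of k] by (intro AE_I2) (simp add: abs_of_pos damped_sq_pos damped_sq_le_const)
    qed
    have le: "(LINT z|\<mu> r. f k z) \<le> M" for k
    proof -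
      have "4 * (1 + 2 * c0 * K) * r \<le> 4 * (1 + 2 * c0 * K) * t"
        using r c0_pos K1 by (intro mult_left_mono) auto
      then have "(LINT z|\<mu> r. f k z) \<le> 2 ^ n * (LINT z|\<mu> 0. f k z)"
        unfolding f_def using r n by (intro damped_moment_le [of _ _ K] e) (auto intro: K)
      also have "(LINT z|\<mu> 0. f k z) \<le> (LINT z|\<mu> 0. (bracket z)\<^sup>2)"
        unfolding f_def by (intro integral_mono' integrable_bracket_sq_0 damped_sq_le e) auto
      finally show ?thesis by (simp add: M_def)
    qed
    have mono: "f k z \<le> f l z" if "k \<le> l" for k l z
    proof -
      have "e l \<le> e k" using that by (simp add: e_def field_simps)
      then have "1 + e l * (bracket z)\<^sup>2 \<le> 1 + e k * (bracket z)\<^sup>2" by (simp add: mult_right_mono)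
      then show ?thesis
        unfolding f_def damped_sq_def using damped_denom [OF e, of l z] by (intro divide_left_mono) auto
    qed
    have "incseq (\<lambda>k. LINT z|\<mu> r. f k z)"
      unfolding incseq_def using int mono by (auto intro!: integral_mono)
    then obtain l where l: "(\<lambda>k. LINT z|\<mu> r. f k z) \<longlonglongrightarrow> l"
      using le incseq_convergent by blast
    have lM: "l \<le> M" using LIMSEQ_le_const2 [OF l] le by blast
    have lim: "(\<lambda>k. f k z) \<longlonglongrightarrow> (bracket z)\<^sup>2" for z
    proof -
      have "e \<longlonglongrightarrow> 0" unfolding e_def by real_asymp
      then have "(\<lambda>k. (bracket z)\<^sup>2 / (1 + e k * (bracket z)\<^sup>2)) \<longlonglongrightarrow> (bracket z)\<^sup>2 / (1 + 0 * (bracket z)\<^sup>2)"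
        by (intro tendsto_intros) auto
      then show ?thesis by (simp add: f_def damped_sq_def)
    qed
    have meas: "(\<lambda>z. (bracket z)\<^sup>2) \<in> borel_measurable (\<mu> r)"
      by (intro measurable_mu r continuous_intros)
    have AE_mono: "AE z in \<mu> r. mono (\<lambda>k. f k z)" using mono by (simp add: mono_def)
    show ?thesis
      using integrable_monotone_convergence [OF int AE_mono AE_I2 [OF lim] l meas]
        integral_monotone_convergence [OF int AE_mono AE_I2 [OF lim] l meas] lM by simp
  qed
  then show ?thesis by blast
qed

lemma integrable_bracket_sq: "r \<ge> 0 \<Longrightarrow> integrable (\<mu> r) (\<lambda>z. (bracket z)\<^sup>2)"
  using second_moment_bounded by blast

lemma integrable_quadratic_growth:
  assumes r: "r \<ge> 0" and f: "continuous_on UNIV f" "\<And>z. \<bar>f z\<bar> \<le> c * (bracket z)\<^sup>2"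
  shows "integrable (\<mu> r) f"
proof (rule Bochner_Integration.integrable_bound [OF integrable_mult_right [OF integrable_bracket_sq [OF r], of c] measurable_mu [OF r f(1)]])
  show "AE z in \<mu> r. norm (f z) \<le> norm (c * (bracket z)\<^sup>2)"
    using order_trans [OF f(2) abs_ge_self] by simp
qed

section \<open>Pairs of independent particles\<close>

lemma pair_sigma_finite_mu: "r \<ge> 0 \<Longrightarrow> pair_sigma_finite (\<mu> r) (\<mu> r)"
  using finite_mu [of r] by (simp add: pair_sigma_finite_def finite_measure_def)

text \<open>The majorant is a product of functions of one particle, so Fubini reduces its
  integrability to the second moment.\<close>

lemma integrable_pair:
  fixes f :: "'d phase \<times> 'd phase \<Rightarrow> real"
  assumes r: "r \<ge> 0" and f: "continuous_on UNIV f" "\<And>z w. \<bar>f (z, w)\<bar> \<le> c * ((bracket z)\<^sup>2 * (bracket w)\<^sup>2)"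
  shows "integrable (\<mu> r \<Otimes>\<^sub>M \<mu> r) f"
proof -
  interpret pair_sigma_finite "\<mu> r" "\<mu> r" by (rule pair_sigma_finite_mu [OF r])
  have base: "integrable (\<mu> r \<Otimes>\<^sub>M \<mu> r) (\<lambda>p. (bracket (fst p))\<^sup>2 * (bracket (snd p))\<^sup>2)"
  proof (rule Fubini_integrable)
    show "(\<lambda>p. (bracket (fst p))\<^sup>2 * (bracket (snd p))\<^sup>2) \<in> borel_measurable (\<mu> r \<Otimes>\<^sub>M \<mu> r)"
      by (intro measurable_pair_mu r continuous_intros)
    show "integrable (\<mu> r) (\<lambda>z. LINT w|\<mu> r. norm ((bracket (fst (z, w)))\<^sup>2 * (bracket (snd (z, w)))\<^sup>2))"
      using integrable_bracket_sq [OF r] by (simp add: abs_mult integrable_mult_left)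
    show "AE z in \<mu> r. integrable (\<mu> r) (\<lambda>w. (bracket (fst (z, w)))\<^sup>2 * (bracket (snd (z, w)))\<^sup>2)"
      using integrable_bracket_sq [OF r] by simp
  qed
  show ?thesis
  proof (rule Bochner_Integration.integrable_bound [OF integrable_mult_right [OF base, of c] measurable_pair_mu [OF r f(1)]])
    show "AE p in \<mu> r \<Otimes>\<^sub>M \<mu> r. norm (f p) \<le> norm (c * ((bracket (fst p))\<^sup>2 * (bracket (snd p))\<^sup>2))"
      using order_trans [OF f(2) abs_ge_self] by (intro AE_I2) (metis prod.collapse real_norm_def)
  qed
qed

lemma integral_pair:
  fixes f :: "'d phase \<times> 'd phase \<Rightarrow> real"
  assumes "r \<ge> 0" "integrable (\<mu> r \<Otimes>\<^sub>M \<mu> r) f"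
  shows "(LINT p|(\<mu> r \<Otimes>\<^sub>M \<mu> r). f p) = (LINT z|\<mu> r. LINT w|\<mu> r. f (z, w))"
    and "(LINT p|(\<mu> r \<Otimes>\<^sub>M \<mu> r). f (snd p, fst p)) = (LINT p|(\<mu> r \<Otimes>\<^sub>M \<mu> r). f p)"
    and "integrable (\<mu> r \<Otimes>\<^sub>M \<mu> r) (\<lambda>p. f (snd p, fst p))"
proof -
  interpret pair_sigma_finite "\<mu> r" "\<mu> r" by (rule pair_sigma_finite_mu [OF assms(1)])
  show "(LINT p|(\<mu> r \<Otimes>\<^sub>M \<mu> r). f p) = (LINT z|\<mu> r. LINT w|\<mu> r. f (z, w))"
    using integral_fst' [OF assms(2)] by simp
  show "(LINT p|(\<mu> r \<Otimes>\<^sub>M \<mu> r). f (snd p, fst p)) = (LINT p|(\<mu> r \<Otimes>\<^sub>M \<mu> r). f p)"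
    using integral_product_swap [of f] assms(2) by (simp add: case_prod_unfold)
  show "integrable (\<mu> r \<Otimes>\<^sub>M \<mu> r) (\<lambda>p. f (snd p, fst p))"
    using integrable_product_swap [OF assms(2)] by (simp add: case_prod_unfold)
qed

lemma norm_add_le_bracket:
  "norm z + norm w \<le> 2 * (bracket z * bracket w)"
proof -
  have "bracket z * 1 \<le> bracket z * bracket w" "1 * bracket w \<le> bracket z * bracket w"
    using bracket_ge_1 [of z] bracket_ge_1 [of w] by (auto intro!: mult_left_mono mult_right_mono)
  then show ?thesis using norm_le_bracket [of z] norm_le_bracket [of w] by simp
qed

text \<open>Symmetrisation: exchanging the two particles preserves the product measure and reverses
  the kernel, so averaging the two versions leaves the difference of \<open>g\<close>. A constant
  \<open>g\<close> gives zero, which is conservation of momentum.\<close>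

lemma force_power:
  assumes r: "r \<ge> 0" and g: "continuous_on UNIV g" "\<And>z. norm (g z) \<le> c * bracket z"
  shows "2 * (LINT z|\<mu> r. (LINT w|\<mu> r. kernel z w) \<bullet> g z)
    = (LINT p|(\<mu> r \<Otimes>\<^sub>M \<mu> r). kernel (fst p) (snd p) \<bullet> (g (fst p) - g (snd p)))"
    and "integrable (\<mu> r \<Otimes>\<^sub>M \<mu> r) (\<lambda>p. kernel (fst p) (snd p) \<bullet> (g (fst p) - g (snd p)))"
    and "integrable (\<mu> r) (\<lambda>z. (LINT w|\<mu> r. kernel z w) \<bullet> g z)"
proof -
  interpret pair_sigma_finite "\<mu> r" "\<mu> r" by (rule pair_sigma_finite_mu [OF r])
  define f where "f = (\<lambda>p::'d phase \<times> 'd phase. kernel (fst p) (snd p) \<bullet> g (fst p))"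
  have int: "integrable (\<mu> r \<Otimes>\<^sub>M \<mu> r) f"
  proof (rule integrable_pair [OF r])
    show "continuous_on UNIV f"
      unfolding f_def by (intro continuous_intros continuous_on_kernel continuous_on_compose2 [OF g(1)]) auto
    fix z w :: "'d phase"
    have "\<bar>f (z, w)\<bar> \<le> norm (kernel z w) * norm (g z)"
      unfolding f_def using Cauchy_Schwarz_ineq2 by auto
    also have "\<dots> \<le> (c0 * (2 * (bracket z * bracket w))) * (c * bracket z)"
      using order_trans [OF norm_kernel_le [of z w] mult_left_mono [OF norm_add_le_bracket [of z w]]] c0_pos g(2) [of z]
      by (intro mult_mono) (auto intro!: mult_nonneg_nonneg simp: bracket_pos less_imp_le)
    also have "\<dots> = 2 * c0 * c * ((bracket z)\<^sup>2 * bracket w)" by (simp add: power2_eq_square)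
    also have "\<dots> \<le> 2 * c0 * c * ((bracket z)\<^sup>2 * (bracket w)\<^sup>2)"
    proof (intro mult_left_mono)
      show "bracket w \<le> (bracket w)\<^sup>2" using bracket_ge_1 [of w] by (simp add: self_le_power)
      have "0 \<le> c * bracket z" using g(2) [of z] norm_ge_zero order_trans by blast
      then show "0 \<le> 2 * c0 * c" using c0_pos bracket_pos [of z] by (simp add: zero_le_mult_iff)
    qed auto
    finally show "\<bar>f (z, w)\<bar> \<le> 2 * c0 * c * ((bracket z)\<^sup>2 * (bracket w)\<^sup>2)" .
  qed
  have eq: "kernel (fst p) (snd p) \<bullet> (g (fst p) - g (snd p)) = f p + f (snd p, fst p)" for p
    using kernel_antisym [of "snd p" "fst p"] by (simp add: f_def inner_diff_right)
  show "integrable (\<mu> r \<Otimes>\<^sub>M \<mu> r) (\<lambda>p. kernel (fst p) (snd p) \<bullet> (g (fst p) - g (snd p)))"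
    unfolding eq by (intro Bochner_Integration.integrable_add int integral_pair(3) r)
  have inner: "(LINT w|\<mu> r. kernel z w) \<bullet> g z = (LINT w|\<mu> r. f (z, w))" for z
    using integral_inner_left [OF integrable_kernel [OF r]] by (simp add: f_def)
  show "integrable (\<mu> r) (\<lambda>z. (LINT w|\<mu> r. kernel z w) \<bullet> g z)"
    unfolding inner by (rule integrable_fst' [OF int])
  have "(LINT z|\<mu> r. (LINT w|\<mu> r. kernel z w) \<bullet> g z) = (LINT z|\<mu> r. LINT w|\<mu> r. f (z, w))"
    by (simp only: inner)
  also have "\<dots> = (LINT p|(\<mu> r \<Otimes>\<^sub>M \<mu> r). f p)"
    by (rule integral_pair(1) [OF r int, symmetric])
  finally show "2 * (LINT z|\<mu> r. (LINT w|\<mu> r. kernel z w) \<bullet> g z)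
    = (LINT p|(\<mu> r \<Otimes>\<^sub>M \<mu> r). kernel (fst p) (snd p) \<bullet> (g (fst p) - g (snd p)))"
    unfolding eq using int integral_pair [OF r int] by simp
qed

definition mean :: "real \<Rightarrow> 'd phase" where
  "mean r = (LINT z|\<mu> r. z)"

lemma abs_quadratic_le:
  fixes A :: "'d phase \<Rightarrow> 'd phase"
  assumes "bounded_linear A"
  shows "\<bar>z \<bullet> A z\<bar> \<le> onorm A * (bracket z)\<^sup>2"
proof -
  have "\<bar>z \<bullet> A z\<bar> \<le> norm z * norm (A z)" by (rule Cauchy_Schwarz_ineq2)
  also have "\<dots> \<le> bracket z * (onorm A * bracket z)"
    using onorm [OF assms, of z] norm_le_bracket [of z] onorm_pos_le [OF assms] bracket_pos [of z]
      mult_left_mono [OF norm_le_bracket [of z] onorm_pos_le [OF assms]]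
    by (intro mult_mono) auto
  finally show ?thesis by (simp add: power2_eq_square algebra_simps)
qed

lemma integrable_quadratic:
  assumes "bounded_linear A" "r \<ge> 0"
  shows "integrable (\<mu> r) (\<lambda>z. z \<bullet> A z)"
  by (rule integrable_quadratic_growth [OF assms(2) _ abs_quadratic_le [OF assms(1)]])
    (intro continuous_intros bounded_linear.continuous_on [OF assms(1)])

text \<open>The identity for the variance of a difference of two independent copies, for an
  arbitrary symmetric form in place of the norm. Symmetry merges the two cross terms, and unit mass
  is what makes constants integrate to themselves.\<close>

lemma pair_quadratic:
  fixes A :: "'d phase \<Rightarrow> 'd phase"
  assumes A: "bounded_linear A" and sym: "\<And>z w. z \<bullet> A w = w \<bullet> A z" and r: "r \<ge> 0"
  shows "integrable (\<mu> r \<Otimes>\<^sub>M \<mu> r) (\<lambda>p. (fst p - snd p) \<bullet> A (fst p - snd p))"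
    and "(LINT p|(\<mu> r \<Otimes>\<^sub>M \<mu> r). (fst p - snd p) \<bullet> A (fst p - snd p))
      = 2 * ((LINT z|\<mu> r. z \<bullet> A z) - mean r \<bullet> A (mean r))"
proof -
  interpret bounded_linear A by (rule A)
  define f where "f = (\<lambda>p. (fst p - snd p) \<bullet> A (fst p - snd p))"
  define I where "I = (LINT z|\<mu> r. z \<bullet> A z)"
  have int: "integrable (\<mu> r \<Otimes>\<^sub>M \<mu> r) f"
  proof (rule integrable_pair [OF r])
    show "continuous_on UNIV f"
      unfolding f_def by (intro continuous_intros bounded_linear.continuous_on [OF A])
    fix z w :: "'d phase"
    have "norm (z - w) \<le> 2 * (bracket z * bracket w)"
      using norm_triangle_ineq4 [of z w] norm_add_le_bracket [of z w] by linarith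
    then have 1: "(norm (z - w))\<^sup>2 \<le> (2 * (bracket z * bracket w))\<^sup>2" by (intro power_mono) auto
    have "\<bar>f (z, w)\<bar> \<le> norm (z - w) * norm (A (z - w))"
      unfolding f_def using Cauchy_Schwarz_ineq2 by auto
    also have "\<dots> \<le> norm (z - w) * (onorm A * norm (z - w))"
      by (intro mult_left_mono onorm [OF A]) simp
    also have "\<dots> = onorm A * (norm (z - w))\<^sup>2" by (simp add: power2_eq_square)
    also have "\<dots> \<le> onorm A * (2 * (bracket z * bracket w))\<^sup>2"
      using 1 by (intro mult_left_mono onorm_pos_le A)
    finally show "\<bar>f (z, w)\<bar> \<le> 4 * onorm A * ((bracket z)\<^sup>2 * (bracket w)\<^sup>2)"
      by (simp add: power_mult_distrib)
  qed
  then show "integrable (\<mu> r \<Otimes>\<^sub>M \<mu> r) (\<lambda>p. (fst p - snd p) \<bullet> A (fst p - snd p))" by (simp add: f_def)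
  have const: "(LINT z|\<mu> r. c) = c" for c :: real
    using integral_const_mu [OF r, of c] mass_eq_1 [OF r] by simp
  have lin: "integrable (\<mu> r) (\<lambda>z. z \<bullet> c)" "(LINT z|\<mu> r. z \<bullet> c) = mean r \<bullet> c" for c
    using integrable_id [OF r] by (simp_all add: mean_def)
  have "(LINT w|\<mu> r. f (z, w)) = (z \<bullet> A z + I) - 2 * (z \<bullet> A (mean r))" for z
  proof -
    have "f (z, w) = (z \<bullet> A z + w \<bullet> A w) - 2 * (w \<bullet> A z)" for w
      using sym [of z w] by (simp add: f_def diff inner_diff_left inner_diff_right)
    then have "(LINT w|\<mu> r. f (z, w)) = ((LINT w|\<mu> r. z \<bullet> A z) + I) - 2 * (LINT w|\<mu> r. w \<bullet> A z)"
      using integrable_quadratic [OF A r] lin(1) integrable_const_mu [OF r] by (simp add: I_def)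
    then show ?thesis using sym [of z "mean r"] by (simp only: const lin(2))
  qed
  then have "(LINT p|(\<mu> r \<Otimes>\<^sub>M \<mu> r). f p) = (LINT z|\<mu> r. (z \<bullet> A z + I) - 2 * (z \<bullet> A (mean r)))"
    using integral_pair(1) [OF r int] by simp
  also have "\<dots> = (I + (LINT z|\<mu> r. I)) - 2 * (LINT z|\<mu> r. z \<bullet> A (mean r))"
    using integrable_quadratic [OF A r] lin(1) integrable_const_mu [OF r] by (simp add: I_def)
  also have "\<dots> = 2 * (I - mean r \<bullet> A (mean r))" by (simp only: const lin(2)) simp
  finally show "(LINT p|(\<mu> r \<Otimes>\<^sub>M \<mu> r). (fst p - snd p) \<bullet> A (fst p - snd p))
      = 2 * ((LINT z|\<mu> r. z \<bullet> A z) - mean r \<bullet> A (mean r))"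
    by (simp add: f_def I_def)
qed

end

section \<open>The Lyapunov functional\<close>

text \<open>An implicit Euler scheme instead of a derivative: evaluated at the right end, the
  hypothesis says that a step of length \<open>h\<close> divides by at least
  \<open>1 + \<gamma> * h\<close>. With \<open>n\<close> equal steps the factor tends to the
  exponential.\<close>

lemma exp_decay:
  fixes e :: "real \<Rightarrow> real"
  assumes decay: "\<And>s t. 0 \<le> s \<Longrightarrow> s \<le> t \<Longrightarrow> e t - e s \<le> - \<gamma> * (t - s) * e t"
    and \<gamma>: "\<gamma> \<ge> 0" and t: "t \<ge> 0"
  shows "e t \<le> e 0 * exp (- \<gamma> * t)"
proof -
  have "(1 + \<gamma> * t / real n) ^ n * e t \<le> e 0" if n: "n \<ge> 1" for n :: nat
  proof -
    define h where "h = t / real n"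
    have h: "h \<ge> 0" using t by (simp add: h_def)
    have "(1 + \<gamma> * h) ^ k * e (real k * h) \<le> e 0" for k
    proof (induction k)
      case (Suc k)
      have "e (real (Suc k) * h) - e (real k * h) \<le> - \<gamma> * (real (Suc k) * h - real k * h) * e (real (Suc k) * h)"
        using h by (intro decay) (auto intro!: mult_right_mono)
      then have "(1 + \<gamma> * h) * e (real (Suc k) * h) \<le> e (real k * h)"
        by (simp add: algebra_simps)
      then have "(1 + \<gamma> * h) ^ k * ((1 + \<gamma> * h) * e (real (Suc k) * h)) \<le> (1 + \<gamma> * h) ^ k * e (real k * h)"
        using h \<gamma> by (intro mult_left_mono) auto
      with Suc show ?case by (simp add: mult.assoc mult.left_commute)
    qed simp
    from this [of n] show ?thesis using n by (simp add: h_def)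
  qed
  then have ev: "eventually (\<lambda>n. (1 + \<gamma> * t / real n) ^ n * e t \<le> e 0) sequentially"
    by (auto simp: eventually_sequentially)
  have "(\<lambda>n. (1 + \<gamma> * t / real n) ^ n * e t) \<longlonglongrightarrow> exp (\<gamma> * t) * e t"
    by (intro tendsto_mult tendsto_exp_limit_sequentially tendsto_const)
  then have "exp (\<gamma> * t) * e t \<le> e 0"
    using ev by (rule tendsto_upperbound) simp
  then have "exp (- \<gamma> * t) * (exp (\<gamma> * t) * e t) \<le> exp (- \<gamma> * t) * e 0"
    by (intro mult_left_mono) auto
  then show ?thesis by (simp add: exp_minus mult.commute field_simps)
qed

text \<open>Here \<open>a\<close>, \<open>c\<close>, \<open>d\<close> stand for the squared norms of
  two vectors and their inner product. By the arithmetic-geometric mean inequality the square of the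
  cross term is at most half of \<open>(lw * a + c)\<^sup>2\<close>; 3/4 is a convenient rational
  above the root of 1/2, and leaves the lower constant 1/4.\<close>

lemma quadratic_form_bounds:
  fixes a c d lw \<alpha> :: real
  assumes "d\<^sup>2 \<le> a * c" "0 \<le> a" "0 \<le> c" "lw > 0" "\<alpha>\<^sup>2 \<le> 2 * lw"
  shows "(lw * a + c) / 4 \<le> lw * a + \<alpha> * d + c" "lw * a + \<alpha> * d + c \<le> 2 * (lw * a + c)"
proof -
  define S where "S = lw * a + c"
  have S: "S \<ge> 0" using assms by (simp add: S_def)
  have "(\<alpha> * d)\<^sup>2 = \<alpha>\<^sup>2 * d\<^sup>2" by (simp add: power_mult_distrib)
  also have "\<dots> \<le> (2 * lw) * (a * c)" using assms by (intro mult_mono) auto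
  also have "\<dots> \<le> (3 / 4 * S)\<^sup>2"
  proof -
    have "0 \<le> (lw * a - c)\<^sup>2" "0 \<le> (lw * a + c)\<^sup>2" by simp_all
    then show ?thesis by (simp add: S_def power2_eq_square algebra_simps)
  qed
  finally have "\<bar>\<alpha> * d\<bar> \<le> 3 / 4 * S" using S abs_le_square_iff [of "\<alpha> * d" "3 / 4 * S"] by simp
  then have "S / 4 \<le> S + \<alpha> * d \<and> S + \<alpha> * d \<le> 2 * S"
    using S by linarith
  then show "(lw * a + c) / 4 \<le> lw * a + \<alpha> * d + c" "lw * a + \<alpha> * d + c \<le> 2 * (lw * a + c)"
    by (simp_all add: S_def algebra_simps)
qed

text \<open>The cross term is absorbed by Young's inequality with weight \<open>lx / lv\<close>; with this
  value of \<open>\<alpha>\<close> that costs all of the \<open>lx\<close>-term and at most the fraction \<open>\<theta>\<close> of the \<open>lw\<close>-term in \<open>a\<close>.\<close>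

lemma dissipation_le:
  fixes a c d p lw lx lv \<phi>m \<phi>M \<theta> \<kappa> \<alpha> :: real
  assumes pos: "lw > 0" "lx > 0" "lv > 0" "\<phi>m > 0" "\<phi>M > 0" "\<theta> > 0"
    and p: "\<phi>m \<le> p" "p \<le> \<phi>M"
    and d: "d\<^sup>2 \<le> a * c" "0 \<le> a" "0 \<le> c"
    and \<kappa>: "\<kappa> = \<theta> * lw / (\<phi>M * lx)" and \<alpha>: "\<alpha> = 2 * lx / (lv * (1 + 2 * \<kappa>))"
  shows "2 * lw * d + \<alpha> * c - ((lw + lx * p) * (\<alpha> * a + 2 * d) + lv * p * (\<alpha> * d + 2 * c))
    \<le> - (\<alpha> * ((1 - \<theta>) * (lw * a) + (- 1 + \<theta> * lw * lv\<^sup>2 / (\<phi>M * lx\<^sup>2) * \<phi>m) * c))"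
proof -
  \<comment> \<open>With Young's weight \<open>u\<close>, the term
    \<open>2 * lv * \<bar>d\<bar>\<close> is at most \<open>lx * a + W * c\<close>.\<close>
  define W where "W = lv\<^sup>2 / lx"
  define u where "u = lx / lv"
  have \<kappa>0: "\<kappa> > 0" using pos by (simp add: \<kappa>)
  have \<alpha>0: "\<alpha> > 0" using pos \<kappa>0 by (simp add: \<alpha> add_pos_pos)
  have W0: "W > 0" and u0: "u > 0" using pos by (simp_all add: W_def u_def)
  have p0: "p > 0" using p pos by linarith
  have lx: "2 * lx = \<alpha> * lv * (1 + 2 * \<kappa>)" using pos \<kappa>0 by (simp add: \<alpha>)
  have lv: "2 * lv = \<alpha> * (1 + 2 * \<kappa>) * W"
  proof -
    have "2 * lv = 2 * lx * (lv / lx)" using pos by simp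
    also have "\<dots> = \<alpha> * (1 + 2 * \<kappa>) * W" unfolding lx by (simp add: W_def power2_eq_square)
    finally show ?thesis .
  qed
  have "(2 * d)\<^sup>2 \<le> (u * a + c / u)\<^sup>2"
  proof -
    have "0 \<le> (u * a - c / u)\<^sup>2" by simp
    then have "4 * (a * c) \<le> (u * a + c / u)\<^sup>2"
      using u0 by (simp add: power2_eq_square algebra_simps)
    then show ?thesis using d by (simp add: power_mult_distrib)
  qed
  then have young: "2 * \<bar>d\<bar> \<le> u * a + c / u"
    using d u0 abs_le_square_iff [of "2 * d" "u * a + c / u"] by (simp add: abs_mult)
  have "(2 * lx + \<alpha> * lv) * p * \<bar>d\<bar> = \<alpha> * (1 + \<kappa>) * p * lv * (2 * \<bar>d\<bar>)"
    unfolding lx by (simp add: algebra_simps)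
  also have "\<dots> \<le> \<alpha> * (1 + \<kappa>) * p * lv * (u * a + c / u)"
    using \<alpha>0 \<kappa>0 p0 pos by (intro mult_left_mono young) auto
  also have "\<dots> = \<alpha> * (1 + \<kappa>) * p * (lx * a + W * c)"
    using pos by (simp add: u_def W_def power2_eq_square field_simps)
  finally have young_d: "(2 * lx + \<alpha> * lv) * p * \<bar>d\<bar> \<le> \<alpha> * (1 + \<kappa>) * p * (lx * a + W * c)" .
  have 1: "- ((2 * lx + \<alpha> * lv) * p * d) \<le> \<alpha> * (1 + \<kappa>) * p * (lx * a + W * c)"
  proof -
    have "0 \<le> (2 * lx + \<alpha> * lv) * p" using pos \<alpha>0 p0 by simp
    from mult_left_mono [OF abs_ge_minus_self [of d] this] show ?thesis
      using young_d by (simp only: mult_minus_right)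
  qed
  have 2: "2 * lv * p * c = \<alpha> * (1 + 2 * \<kappa>) * W * p * c" unfolding lv by simp
  \<comment> \<open>\<kappa> is defined so that
    \<open>\<kappa> * lx * \<phi>M = \<theta> * lw\<close>. The upper bound of the communication
    rate is spent here, the lower one in the next estimate.\<close>
  have 3: "\<alpha> * \<kappa> * lx * p * a \<le> \<alpha> * \<theta> * lw * a"
  proof -
    have "\<kappa> * lx * p = \<theta> * lw * (p / \<phi>M)" using pos by (simp add: \<kappa>)
    also have "\<dots> \<le> \<theta> * lw * 1" using pos p by (intro mult_left_mono) (auto simp: divide_le_eq)
    finally have "\<alpha> * a * (\<kappa> * lx * p) \<le> \<alpha> * a * (\<theta> * lw)" using \<alpha>0 d by (intro mult_left_mono) auto
    then show ?thesis by (simp add: algebra_simps)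
  qed
  have 4: "\<alpha> * (\<theta> * lw * lv\<^sup>2 / (\<phi>M * lx\<^sup>2) * \<phi>m) * c \<le> \<alpha> * \<kappa> * W * p * c"
  proof -
    have "\<kappa> * W * p = \<theta> * lw * lv\<^sup>2 / (\<phi>M * lx\<^sup>2) * p" by (simp add: \<kappa> W_def power2_eq_square)
    moreover have "\<theta> * lw * lv\<^sup>2 / (\<phi>M * lx\<^sup>2) * \<phi>m \<le> \<theta> * lw * lv\<^sup>2 / (\<phi>M * lx\<^sup>2) * p"
      using pos p by (intro mult_left_mono) auto
    ultimately have "\<alpha> * c * (\<theta> * lw * lv\<^sup>2 / (\<phi>M * lx\<^sup>2) * \<phi>m) \<le> \<alpha> * c * (\<kappa> * W * p)"
      using \<alpha>0 d by (intro mult_left_mono) auto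
    then show ?thesis by (simp add: algebra_simps)
  qed
  have "2 * lw * d + \<alpha> * c - ((lw + lx * p) * (\<alpha> * a + 2 * d) + lv * p * (\<alpha> * d + 2 * c))
    = \<alpha> * c - \<alpha> * lw * a - \<alpha> * lx * p * a - 2 * lv * p * c - (2 * lx + \<alpha> * lv) * p * d"
    by (simp add: algebra_simps)
  \<comment> \<open>Up to the factor \<open>\<alpha> * p\<close>, Young's inequality costs
    \<open>1 + \<kappa>\<close> times \<open>lx * a + W * c\<close>. Available are 1 times
    \<open>lx * a\<close> and \<open>1 + 2 * \<kappa>\<close> times \<open>W * c\<close>: a deficit
    \<kappa> in \<open>a\<close> and a surplus \<kappa> in \<open>c\<close> remain.\<close>
  also have "\<dots> \<le> \<alpha> * c - \<alpha> * lw * a + \<alpha> * \<kappa> * lx * p * a - \<alpha> * \<kappa> * W * p * c"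
    using 1 unfolding 2 by (simp add: algebra_simps)
  also have "\<dots> \<le> \<alpha> * c - \<alpha> * lw * a + \<alpha> * \<theta> * lw * a - \<alpha> * (\<theta> * lw * lv\<^sup>2 / (\<phi>M * lx\<^sup>2) * \<phi>m) * c"
    using 3 4 by linarith
  also have "\<dots> = - (\<alpha> * ((1 - \<theta>) * (lw * a) + (- 1 + \<theta> * lw * lv\<^sup>2 / (\<phi>M * lx\<^sup>2) * \<phi>m) * c))"
    by (simp add: algebra_simps)
  finally show ?thesis .
qed

section \<open>Quadratic observables, motion of the mean, and the energy balance\<close>

context herding
begin

definition gram :: "real \<Rightarrow> 'd phase \<Rightarrow> 'd phase" where
  "gram \<alpha> z = (lw *\<^sub>R fst z + (\<alpha> / 2) *\<^sub>R snd z, (\<alpha> / 2) *\<^sub>R fst z + snd z)"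

text \<open>The symmetric operator whose quadratic form is the derivative of
  \<open>z \<bullet> gram \<alpha> z\<close> along free streaming, where x moves with velocity v and
  v is constant.\<close>

definition flux :: "real \<Rightarrow> 'd phase \<Rightarrow> 'd phase" where
  "flux \<alpha> z = (lw *\<^sub>R snd z, lw *\<^sub>R fst z + \<alpha> *\<^sub>R snd z)"

lemma bounded_linear_gram: "bounded_linear (gram \<alpha>)"
  and bounded_linear_flux: "bounded_linear (flux \<alpha>)"
  unfolding linear_conv_bounded_linear [symmetric]
  by (auto intro!: linearI simp: gram_def flux_def algebra_simps)

lemma gram_sym: "z \<bullet> gram \<alpha> w = w \<bullet> gram \<alpha> z"
  and flux_sym: "z \<bullet> flux \<alpha> w = w \<bullet> flux \<alpha> z"
  by (simp_all add: gram_def flux_def inner_prod_def inner_add_right inner_commute algebra_simps)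

lemma GDERIV_quadratic:
  fixes A :: "'d phase \<Rightarrow> 'd phase"
  assumes A: "bounded_linear A" and sym: "\<And>z w. z \<bullet> A w = w \<bullet> A z"
  shows "GDERIV (\<lambda>z. z \<bullet> A z) z :> 2 *\<^sub>R A z"
  unfolding gderiv_def
  by (rule has_derivative_eq_rhs [OF has_derivative_inner [OF has_derivative_ident
        bounded_linear.has_derivative [OF A has_derivative_ident]]])
    (simp add: fun_eq_iff sym [of z])

lemma weak_quadratic:
  fixes A :: "'d phase \<Rightarrow> 'd phase"
  assumes A: "bounded_linear A" and sym: "\<And>z w. z \<bullet> A w = w \<bullet> A z" and st: "0 \<le> s" "s \<le> t"
  shows "set_integrable lborel {s..t} (\<lambda>r. LINT z|\<mu> r. F r z \<bullet> (2 *\<^sub>R A z))"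
    and "(LINT z|\<mu> t. z \<bullet> A z) - (LINT z|\<mu> s. z \<bullet> A z) = (LINT r:{s..t}|lborel. (LINT z|\<mu> r. F r z \<bullet> (2 *\<^sub>R A z)))"
proof -
  obtain M where M: "\<And>r. 0 \<le> r \<Longrightarrow> r \<le> t \<Longrightarrow> integrable (\<mu> r) (\<lambda>z. (bracket z)\<^sup>2)"
    "\<And>r. 0 \<le> r \<Longrightarrow> r \<le> t \<Longrightarrow> (LINT z|\<mu> r. (bracket z)\<^sup>2) \<le> M"
    using second_moment_bounded [of t] st by auto
  have cont: "continuous_on UNIV (\<lambda>z. 2 *\<^sub>R A z)"
    by (intro continuous_intros bounded_linear.continuous_on [OF A])
  have bd: "\<bar>z \<bullet> A z\<bar> \<le> 2 * onorm A * bracket z ^ Suc 1" "norm (2 *\<^sub>R A z) \<le> 2 * onorm A * bracket z ^ 1" for z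
  proof -
    have "0 \<le> onorm A * (bracket z)\<^sup>2" using onorm_pos_le [OF A] by simp
    then show "\<bar>z \<bullet> A z\<bar> \<le> 2 * onorm A * bracket z ^ Suc 1"
      using abs_quadratic_le [OF A, of z] by (simp add: numeral_2_eq_2)
    show "norm (2 *\<^sub>R A z) \<le> 2 * onorm A * bracket z ^ 1"
      using order_trans [OF onorm [OF A, of z] mult_left_mono [OF norm_le_bracket [of z] onorm_pos_le [OF A]]]
      by simp
  qed
  have mom: "integrable (\<mu> r) (\<lambda>z. bracket z ^ Suc 1)" "(LINT z|\<mu> r. bracket z ^ Suc 1) \<le> M"
    if "s \<le> r" "r \<le> t" for r
    using M [of r] that st by (simp_all add: numeral_2_eq_2)
  show "set_integrable lborel {s..t} (\<lambda>r. LINT z|\<mu> r. F r z \<bullet> (2 *\<^sub>R A z))"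
    by (rule weak_growth(1) [OF GDERIV_quadratic [OF A sym] cont bd mom st])
  show "(LINT z|\<mu> t. z \<bullet> A z) - (LINT z|\<mu> s. z \<bullet> A z) = (LINT r:{s..t}|lborel. (LINT z|\<mu> r. F r z \<bullet> (2 *\<^sub>R A z)))"
    by (rule weak_growth(2) [OF GDERIV_quadratic [OF A sym] cont bd mom st])
qed

lemma mean_inner: "r \<ge> 0 \<Longrightarrow> (LINT z|\<mu> r. z \<bullet> e) = mean r \<bullet> e"
  using integrable_id [of r] by (simp add: mean_def)

lemma fst_mean: "r \<ge> 0 \<Longrightarrow> mean_x (\<mu> r) = fst (mean r)"
  and snd_mean: "r \<ge> 0 \<Longrightarrow> mean_v (\<mu> r) = snd (mean r)"
  using integral_bounded_linear [OF bounded_linear_fst integrable_id [of r]]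
    integral_bounded_linear [OF bounded_linear_snd integrable_id [of r]]
  by (simp_all add: mean_x_def mean_v_def mean_def)

text \<open>Linear test functions need only the first moment. The force drops out because its power
  against a constant vanishes by symmetrisation.\<close>

lemma mean_weak:
  assumes t: "t \<ge> 0"
  shows "mean t \<bullet> e - mean 0 \<bullet> e = (LINT r:{0..t}|lborel. snd (mean r) \<bullet> fst e)"
proof -
  obtain K where K: "\<And>r. 0 \<le> r \<Longrightarrow> r \<le> t \<Longrightarrow> moment r \<le> K" using moment_bounded by blast
  have dG: "GDERIV (\<lambda>z. z \<bullet> e) z :> e" for z
    unfolding gderiv_def by (auto intro!: derivative_eq_intros)
  have bd: "\<bar>z \<bullet> e\<bar> \<le> norm e * bracket z ^ Suc 0" "norm e \<le> norm e * bracket z ^ 0" for z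
    using order_trans [OF Cauchy_Schwarz_ineq2 mult_right_mono [OF norm_le_bracket norm_ge_zero], of z e]
    by (simp_all add: mult.commute)
  have mom: "integrable (\<mu> r) (\<lambda>z. bracket z ^ Suc 0)" "(LINT z|\<mu> r. bracket z ^ Suc 0) \<le> K"
    if "0 \<le> r" "r \<le> t" for r
    using K [OF that] integrable_bracket [of r] that by (simp_all add: moment_def)
  have "(LINT z|\<mu> r. F r z \<bullet> e) = snd (mean r) \<bullet> fst e" if r: "r \<ge> 0" for r
  proof -
    have "norm (snd e) \<le> norm (snd e) * bracket z" for z :: "'d phase"
      using mult_left_mono [OF bracket_ge_1 [of z] norm_ge_zero [of "snd e"]] by simp
    then have Q: "(LINT z|\<mu> r. (LINT w|\<mu> r. kernel z w) \<bullet> snd e) = 0"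
      "integrable (\<mu> r) (\<lambda>z. (LINT w|\<mu> r. kernel z w) \<bullet> snd e)"
      using force_power [OF r continuous_on_const, of "snd e" "norm (snd e)"] by simp_all
    have eq: "F r z \<bullet> e = z \<bullet> (0, fst e) + (LINT w|\<mu> r. kernel z w) \<bullet> snd e" for z
      by (simp add: F_def herding_force_kernel inner_prod_def)
    have "(LINT z|\<mu> r. F r z \<bullet> e) = mean r \<bullet> (0, fst e) + 0"
      unfolding eq using Q integrable_id [OF r] mean_inner [OF r, of "(0, fst e)"]
      by (subst Bochner_Integration.integral_add) auto
    then show ?thesis by (simp add: inner_prod_def)
  qed
  then have "(LINT r:{0..t}|lborel. (LINT z|\<mu> r. F r z \<bullet> e)) = (LINT r:{0..t}|lborel. snd (mean r) \<bullet> fst e)"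
    by (intro set_lebesgue_integral_cong) auto
  then show ?thesis
    using weak_growth(2) [OF dG continuous_on_const bd mom _ t] mean_inner [OF t] mean_inner [of 0] by simp
qed

text \<open>Testing velocity directions first shows that the mean velocity is constant; the mean
  position is then its integral. The explicit affine path later allows differentiating quadratic
  forms of the mean.\<close>

lemma mean_eq: "t \<ge> 0 \<Longrightarrow> mean t = mean 0 + t *\<^sub>R (snd (mean 0), 0)"
proof -
  have v: "snd (mean t) = snd (mean 0)" if "t \<ge> 0" for t
  proof -
    have "snd (mean t) \<bullet> e = snd (mean 0) \<bullet> e" for e
      using mean_weak [OF that, of "(0, e)"] by (simp add: inner_prod_def set_lebesgue_integral_def)
    then show ?thesis by (rule vector_eq_rdot [THEN iffD1, OF allI])
  qed
  assume t: "t \<ge> 0"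
  have "mean t \<bullet> e = (mean 0 + t *\<^sub>R (snd (mean 0), 0)) \<bullet> e" for e
  proof -
    have "(LINT r:{0..t}|lborel. snd (mean r) \<bullet> fst e) = (LINT r:{0..t}|lborel. snd (mean 0) \<bullet> fst e)"
    proof (rule set_lebesgue_integral_cong)
      show "\<forall>r. r \<in> {0..t} \<longrightarrow> snd (mean r) \<bullet> fst e = snd (mean 0) \<bullet> fst e"
        using v by (metis atLeastAtMost_iff)
    qed simp
    also have "\<dots> = t * (snd (mean 0) \<bullet> fst e)" using t by (simp add: set_lebesgue_integral_def)
    finally have "mean t \<bullet> e = mean 0 \<bullet> e + t * (snd (mean 0) \<bullet> fst e)"
      using mean_weak [OF t, of e] by linarith
    then show ?thesis by (simp add: inner_add_left inner_prod_def [of "(_, _)"])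
  qed
  then show ?thesis by (rule vector_eq_rdot [THEN iffD1, OF allI])
qed

text \<open>Written as a moment minus its value at the mean because the two parts evolve by
  different arguments: the weak formulation and the explicit motion of the mean.\<close>

definition energy :: "real \<Rightarrow> real \<Rightarrow> real" where
  "energy \<alpha> t = (LINT z|\<mu> t. z \<bullet> gram \<alpha> z) - mean t \<bullet> gram \<alpha> (mean t)"

definition dissipation :: "real \<Rightarrow> 'd phase \<times> 'd phase \<Rightarrow> real" where
  "dissipation \<alpha> p = (fst p - snd p) \<bullet> flux \<alpha> (fst p - snd p)
     + kernel (fst p) (snd p) \<bullet> (\<alpha> *\<^sub>R fst (fst p - snd p) + 2 *\<^sub>R snd (fst p - snd p))"

lemma energy_pair:
  assumes "t \<ge> 0"
  shows "energy \<alpha> t = (LINT p|(\<mu> t \<Otimes>\<^sub>M \<mu> t). (fst p - snd p) \<bullet> gram \<alpha> (fst p - snd p)) / 2"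
  unfolding energy_def pair_quadratic(2) [OF bounded_linear_gram gram_sym assms] by simp

lemma mean_quadratic_diff:
  assumes st: "0 \<le> s" "s \<le> t"
  shows "set_integrable lborel {s..t} (\<lambda>r. mean r \<bullet> flux \<alpha> (mean r))"
    and "mean t \<bullet> gram \<alpha> (mean t) - mean s \<bullet> gram \<alpha> (mean s) = (LINT r:{s..t}|lborel. mean r \<bullet> flux \<alpha> (mean r))"
proof -
  define d where "d = (snd (mean 0), 0 :: real ^ 'd)"
  define q where "q = (\<lambda>r. mean 0 + r *\<^sub>R d)"
  have q: "mean r = q r" if "r \<ge> 0" for r
    unfolding q_def d_def by (rule mean_eq [OF that])
  have dq: "(q has_vector_derivative d) (at r within S)" for r S
    unfolding q_def by (auto intro!: derivative_eq_intros)
  have flux: "q r \<bullet> gram \<alpha> d + d \<bullet> gram \<alpha> (q r) = q r \<bullet> flux \<alpha> (q r)" for r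
    unfolding gram_sym [of "q r" \<alpha> d]
    by (simp add: gram_def flux_def inner_prod_def q_def d_def algebra_simps inner_commute)
  have dE: "((\<lambda>r. q r \<bullet> gram \<alpha> (q r)) has_vector_derivative q r \<bullet> flux \<alpha> (q r)) (at r within S)" for r S
    unfolding flux [symmetric]
    by (rule bounded_bilinear.has_vector_derivative [OF bounded_bilinear_inner dq
          bounded_linear.has_vector_derivative [OF bounded_linear_gram dq]])
  have cont: "continuous_on S (\<lambda>r. q r \<bullet> flux \<alpha> (q r))" for S
    unfolding q_def by (intro continuous_intros bounded_linear.continuous_on [OF bounded_linear_flux])
  have "set_integrable lborel {s..t} (\<lambda>r. q r \<bullet> flux \<alpha> (q r))"
    by (rule borel_integrable_atLeastAtMost' [OF cont])
  moreover have "set_integrable lborel {s..t} (\<lambda>r. mean r \<bullet> flux \<alpha> (mean r))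
      \<longleftrightarrow> set_integrable lborel {s..t} (\<lambda>r. q r \<bullet> flux \<alpha> (q r))"
    using st q by (intro set_integrable_cong) auto
  ultimately show "set_integrable lborel {s..t} (\<lambda>r. mean r \<bullet> flux \<alpha> (mean r))" by simp
  have "(LINT r:{s..t}|lborel. mean r \<bullet> flux \<alpha> (mean r)) = (LINT r:{s..t}|lborel. q r \<bullet> flux \<alpha> (q r))"
    using st q by (intro set_lebesgue_integral_cong) auto
  also have "\<dots> = q t \<bullet> gram \<alpha> (q t) - q s \<bullet> gram \<alpha> (q s)"
    unfolding set_lebesgue_integral_def by (rule integral_FTC_atLeastAtMost [OF st(2) dE cont])
  finally show "mean t \<bullet> gram \<alpha> (mean t) - mean s \<bullet> gram \<alpha> (mean s) = (LINT r:{s..t}|lborel. mean r \<bullet> flux \<alpha> (mean r))"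
    using q st by simp
qed

text \<open>The mean moves by free streaming, so its contribution is the flux form at the mean.
  Subtracting it turns the flux moment into a pair integral, and symmetrisation does the same for
  the force.\<close>

lemma power_pair:
  assumes r: "r \<ge> 0"
  shows "integrable (\<mu> r \<Otimes>\<^sub>M \<mu> r) (dissipation \<alpha>)"
    and "(LINT z|\<mu> r. F r z \<bullet> (2 *\<^sub>R gram \<alpha> z)) - mean r \<bullet> flux \<alpha> (mean r)
      = (LINT p|(\<mu> r \<Otimes>\<^sub>M \<mu> r). dissipation \<alpha> p) / 2"
proof -
  \<comment> \<open>The velocity component of the gradient
    \<open>2 *\<^sub>R gram \<alpha> z\<close>, the only one on which the force acts.\<close>
  define g where "g = (\<lambda>z::'d phase. \<alpha> *\<^sub>R fst z + 2 *\<^sub>R snd z)"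
  have cg: "continuous_on UNIV g" unfolding g_def by (intro continuous_intros)
  have gb: "norm (g z) \<le> (\<bar>\<alpha>\<bar> + 2) * bracket z" for z
  proof -
    have "norm (g z) \<le> \<bar>\<alpha>\<bar> * norm (fst z) + 2 * norm (snd z)"
      unfolding g_def by (rule norm_triangle_le) simp
    also have "\<dots> \<le> \<bar>\<alpha>\<bar> * bracket z + 2 * bracket z"
      using order_trans [OF norm_fst_le_norm norm_le_bracket, of z] order_trans [OF norm_snd_le_norm norm_le_bracket, of z]
      by (intro add_mono mult_left_mono) auto
    finally show ?thesis by (simp add: algebra_simps)
  qed
  have diss: "dissipation \<alpha> p = (fst p - snd p) \<bullet> flux \<alpha> (fst p - snd p)
      + kernel (fst p) (snd p) \<bullet> (g (fst p) - g (snd p))" for p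
    by (simp add: dissipation_def g_def algebra_simps)
  note fl = pair_quadratic [OF bounded_linear_flux [of \<alpha>] flux_sym r]
  note fp = force_power [OF r cg gb]
  show "integrable (\<mu> r \<Otimes>\<^sub>M \<mu> r) (dissipation \<alpha>)"
    unfolding diss [abs_def] by (intro Bochner_Integration.integrable_add fl(1) fp(2))
  have eq: "F r z \<bullet> (2 *\<^sub>R gram \<alpha> z) = z \<bullet> flux \<alpha> z + (LINT w|\<mu> r. kernel z w) \<bullet> g z" for z
    by (simp add: F_def herding_force_kernel gram_def flux_def g_def inner_prod_def inner_add_right
        inner_commute algebra_simps)
  have "(LINT z|\<mu> r. F r z \<bullet> (2 *\<^sub>R gram \<alpha> z)) = (LINT z|\<mu> r. z \<bullet> flux \<alpha> z) + (LINT z|\<mu> r. (LINT w|\<mu> r. kernel z w) \<bullet> g z)"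
    unfolding eq by (intro Bochner_Integration.integral_add integrable_quadratic bounded_linear_flux r fp(3))
  moreover have "(LINT p|(\<mu> r \<Otimes>\<^sub>M \<mu> r). dissipation \<alpha> p)
      = 2 * ((LINT z|\<mu> r. z \<bullet> flux \<alpha> z) - mean r \<bullet> flux \<alpha> (mean r)) + 2 * (LINT z|\<mu> r. (LINT w|\<mu> r. kernel z w) \<bullet> g z)"
    unfolding diss fp(1) fl(2) [symmetric] by (intro Bochner_Integration.integral_add fl(1) fp(2))
  ultimately show "(LINT z|\<mu> r. F r z \<bullet> (2 *\<^sub>R gram \<alpha> z)) - mean r \<bullet> flux \<alpha> (mean r)
      = (LINT p|(\<mu> r \<Otimes>\<^sub>M \<mu> r). dissipation \<alpha> p) / 2" by simp
qed

lemma energy_diff: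
  assumes st: "0 \<le> s" "s \<le> t"
  shows "set_integrable lborel {s..t} (\<lambda>r. (LINT p|(\<mu> r \<Otimes>\<^sub>M \<mu> r). dissipation \<alpha> p) / 2)"
    and "energy \<alpha> t - energy \<alpha> s = (LINT r:{s..t}|lborel. (LINT p|(\<mu> r \<Otimes>\<^sub>M \<mu> r). dissipation \<alpha> p) / 2)"
proof -
  define h where "h = (\<lambda>r. (LINT z|\<mu> r. F r z \<bullet> (2 *\<^sub>R gram \<alpha> z)) - mean r \<bullet> flux \<alpha> (mean r))"
  note wq = weak_quadratic [OF bounded_linear_gram [of \<alpha>] gram_sym st]
  note mq = mean_quadratic_diff [OF st, of \<alpha>]
  have h: "set_integrable lborel {s..t} h"
    unfolding h_def by (intro set_integral_diff wq(1) mq(1))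
  have eq: "h r = (LINT p|(\<mu> r \<Otimes>\<^sub>M \<mu> r). dissipation \<alpha> p) / 2" if "r \<in> {s..t}" for r
    unfolding h_def using that st by (intro power_pair(2)) auto
  have "set_integrable lborel {s..t} h
      \<longleftrightarrow> set_integrable lborel {s..t} (\<lambda>r. (LINT p|(\<mu> r \<Otimes>\<^sub>M \<mu> r). dissipation \<alpha> p) / 2)"
    using eq by (intro set_integrable_cong) auto
  with h show "set_integrable lborel {s..t} (\<lambda>r. (LINT p|(\<mu> r \<Otimes>\<^sub>M \<mu> r). dissipation \<alpha> p) / 2)" by simp
  have "energy \<alpha> t - energy \<alpha> s = (LINT r:{s..t}|lborel. h r)"
    unfolding h_def set_integral_diff(2) [OF wq(1) mq(1)] wq(2) [symmetric] mq(2) [symmetric]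
    by (simp add: energy_def)
  also have "\<dots> = (LINT r:{s..t}|lborel. (LINT p|(\<mu> r \<Otimes>\<^sub>M \<mu> r). dissipation \<alpha> p) / 2)"
    using eq by (intro set_lebesgue_integral_cong) auto
  finally show "energy \<alpha> t - energy \<alpha> s = (LINT r:{s..t}|lborel. (LINT p|(\<mu> r \<Otimes>\<^sub>M \<mu> r). dissipation \<alpha> p) / 2)" .
qed

end

section \<open>Comparison of energy and variance, and exponential decay\<close>

context herding
begin

definition variance :: "real \<Rightarrow> real" where
  "variance r = (LINT z|\<mu> r. z \<bullet> z) - mean r \<bullet> mean r"

lemma variance_pair:
  assumes "r \<ge> 0"
  shows "integrable (\<mu> r \<Otimes>\<^sub>M \<mu> r) (\<lambda>p. (fst p - snd p) \<bullet> (fst p - snd p))"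
    and "variance r = (LINT p|(\<mu> r \<Otimes>\<^sub>M \<mu> r). (fst p - snd p) \<bullet> (fst p - snd p)) / 2"
proof -
  note pq = pair_quadratic [OF bounded_linear_ident _ assms, OF inner_commute]
  show "integrable (\<mu> r \<Otimes>\<^sub>M \<mu> r) (\<lambda>p. (fst p - snd p) \<bullet> (fst p - snd p))" by (rule pq(1))
  show "variance r = (LINT p|(\<mu> r \<Otimes>\<^sub>M \<mu> r). (fst p - snd p) \<bullet> (fst p - snd p)) / 2"
    unfolding variance_def pq(2) by simp
qed

lemma variance_nonneg: "r \<ge> 0 \<Longrightarrow> variance r \<ge> 0"
  unfolding variance_pair(2) by simp

lemma integral_deviation:
  assumes r: "r \<ge> 0"
  shows "integrable (\<mu> r) (\<lambda>z. (z - mean r) \<bullet> (z - mean r))"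
    and "(LINT z|\<mu> r. (z - mean r) \<bullet> (z - mean r)) = variance r"
proof -
  have eq: "(z - mean r) \<bullet> (z - mean r) = (z \<bullet> z + mean r \<bullet> mean r) - 2 * (z \<bullet> mean r)" for z
    by (simp add: inner_diff_left inner_diff_right inner_commute)
  have sq: "integrable (\<mu> r) (\<lambda>z. z \<bullet> z)" by (rule integrable_quadratic [OF bounded_linear_ident r])
  have lin: "integrable (\<mu> r) (\<lambda>z. z \<bullet> mean r)" using integrable_id [OF r] by simp
  show "integrable (\<mu> r) (\<lambda>z. (z - mean r) \<bullet> (z - mean r))"
    unfolding eq using sq lin integrable_const_mu [OF r] by simp
  have "(LINT z|\<mu> r. (z - mean r) \<bullet> (z - mean r))
      = ((LINT z|\<mu> r. z \<bullet> z) + (LINT z|\<mu> r. mean r \<bullet> mean r)) - 2 * (LINT z|\<mu> r. z \<bullet> mean r)"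
    unfolding eq using sq lin integrable_const_mu [OF r] by simp
  also have "\<dots> = variance r"
    unfolding integral_const_mu [OF r] mass_eq_1 [OF r] mean_inner [OF r] variance_def by simp
  finally show "(LINT z|\<mu> r. (z - mean r) \<bullet> (z - mean r)) = variance r" .
qed

lemma gram_bounds:
  assumes \<alpha>: "\<alpha>\<^sup>2 \<le> 2 * lw"
  shows "(lw * (fst z \<bullet> fst z) + snd z \<bullet> snd z) / 4 \<le> z \<bullet> gram \<alpha> z"
    and "z \<bullet> gram \<alpha> z \<le> 2 * (lw * (fst z \<bullet> fst z) + snd z \<bullet> snd z)"
proof -
  have "z \<bullet> gram \<alpha> z = lw * (fst z \<bullet> fst z) + \<alpha> * (fst z \<bullet> snd z) + snd z \<bullet> snd z"
    by (simp add: gram_def inner_prod_def inner_add_right inner_commute algebra_simps)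
  then show "(lw * (fst z \<bullet> fst z) + snd z \<bullet> snd z) / 4 \<le> z \<bullet> gram \<alpha> z"
    "z \<bullet> gram \<alpha> z \<le> 2 * (lw * (fst z \<bullet> fst z) + snd z \<bullet> snd z)"
    using quadratic_form_bounds [OF Cauchy_Schwarz_ineq [of "fst z" "snd z"] _ _ lw \<alpha>] by simp_all
qed

lemma energy_bounds:
  assumes \<alpha>: "\<alpha>\<^sup>2 \<le> 2 * lw" and r: "r \<ge> 0"
  shows "min 1 lw / 4 * variance r \<le> energy \<alpha> r" and "energy \<alpha> r \<le> 2 * max 1 lw * variance r"
proof -
  note g = pair_quadratic(1) [OF bounded_linear_gram [of \<alpha>] gram_sym r]
  note v = variance_pair(1) [OF r]
  have "min 1 lw / 4 * (z \<bullet> z) \<le> z \<bullet> gram \<alpha> z \<and> z \<bullet> gram \<alpha> z \<le> 2 * max 1 lw * (z \<bullet> z)" for z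
  proof -
    have "min 1 lw * (fst z \<bullet> fst z) + min 1 lw * (snd z \<bullet> snd z) \<le> lw * (fst z \<bullet> fst z) + 1 * (snd z \<bullet> snd z)"
      "lw * (fst z \<bullet> fst z) + 1 * (snd z \<bullet> snd z) \<le> max 1 lw * (fst z \<bullet> fst z) + max 1 lw * (snd z \<bullet> snd z)"
      by (intro add_mono mult_right_mono; simp)+
    then show ?thesis
      using gram_bounds [OF \<alpha>, of z] by (simp add: inner_prod_def [of z z] algebra_simps)
  qed
  then have le: "min 1 lw / 4 * (z \<bullet> z) \<le> z \<bullet> gram \<alpha> z" "z \<bullet> gram \<alpha> z \<le> 2 * max 1 lw * (z \<bullet> z)" for z
    by blast+
  have "(LINT p|(\<mu> r \<Otimes>\<^sub>M \<mu> r). min 1 lw / 4 * ((fst p - snd p) \<bullet> (fst p - snd p)))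
      \<le> (LINT p|(\<mu> r \<Otimes>\<^sub>M \<mu> r). (fst p - snd p) \<bullet> gram \<alpha> (fst p - snd p))"
    by (intro integral_mono integrable_mult_right v g le)
  then show "min 1 lw / 4 * variance r \<le> energy \<alpha> r"
    unfolding energy_pair [OF r] variance_pair(2) [OF r] by simp
  have "(LINT p|(\<mu> r \<Otimes>\<^sub>M \<mu> r). (fst p - snd p) \<bullet> gram \<alpha> (fst p - snd p))
      \<le> (LINT p|(\<mu> r \<Otimes>\<^sub>M \<mu> r). 2 * max 1 lw * ((fst p - snd p) \<bullet> (fst p - snd p)))"
    by (intro integral_mono integrable_mult_right v g le)
  then show "energy \<alpha> r \<le> 2 * max 1 lw * variance r"
    unfolding energy_pair [OF r] variance_pair(2) [OF r] by simp
qed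

text \<open>Two passes over the integral identity. Nonnegativity of the energy first gives
  monotonicity; on \<open>{s..t}\<close> the energy is then at least its value at \<open>t\<close>,
  which yields the right-endpoint inequality required by \<open>exp_decay\<close>.\<close>

lemma energy_decay:
  assumes diss: "\<And>p. dissipation \<alpha> p \<le> - \<gamma> * ((fst p - snd p) \<bullet> gram \<alpha> (fst p - snd p))"
    and \<gamma>: "\<gamma> \<ge> 0" and \<alpha>: "\<alpha>\<^sup>2 \<le> 2 * lw" and t: "t \<ge> 0"
  shows "energy \<alpha> t \<le> energy \<alpha> 0 * exp (- \<gamma> * t)"
proof (rule exp_decay [OF _ \<gamma> t])
  have nonneg: "energy \<alpha> r \<ge> 0" if "r \<ge> 0" for r
  proof -
    have "0 \<le> min 1 lw / 4 * variance r" using variance_nonneg [OF that] lw by simp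
    then show ?thesis using energy_bounds(1) [OF \<alpha> that] by linarith
  qed
  have le: "(LINT p|(\<mu> r \<Otimes>\<^sub>M \<mu> r). dissipation \<alpha> p) / 2 \<le> - \<gamma> * energy \<alpha> r" if r: "r \<ge> 0" for r
  proof -
    have "(LINT p|(\<mu> r \<Otimes>\<^sub>M \<mu> r). dissipation \<alpha> p)
        \<le> (LINT p|(\<mu> r \<Otimes>\<^sub>M \<mu> r). - \<gamma> * ((fst p - snd p) \<bullet> gram \<alpha> (fst p - snd p)))"
      by (intro integral_mono power_pair(1) r integrable_mult_right diss
          pair_quadratic(1) [OF bounded_linear_gram gram_sym r])
    then show ?thesis by (simp add: energy_pair [OF r])
  qed
  have mono: "energy \<alpha> t \<le> energy \<alpha> s" if st: "0 \<le> s" "s \<le> t" for s t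
  proof -
    have "(LINT r:{s..t}|lborel. (LINT p|(\<mu> r \<Otimes>\<^sub>M \<mu> r). dissipation \<alpha> p) / 2) \<le> 0 * (t - s)"
    proof (rule set_lebesgue_integral_le [OF energy_diff(1) [OF st] st(2)])
      fix r assume "s \<le> r" "r \<le> t"
      then have "0 \<le> r" using st by simp
      from le [OF this] mult_nonneg_nonneg [OF \<gamma> nonneg [OF this]]
      show "(LINT p|(\<mu> r \<Otimes>\<^sub>M \<mu> r). dissipation \<alpha> p) / 2 \<le> 0" by linarith
    qed
    then show ?thesis using energy_diff(2) [OF st, of \<alpha>] by simp
  qed
  fix s t :: real assume st: "0 \<le> s" "s \<le> t"
  have "(LINT r:{s..t}|lborel. (LINT p|(\<mu> r \<Otimes>\<^sub>M \<mu> r). dissipation \<alpha> p) / 2) \<le> (- \<gamma> * energy \<alpha> t) * (t - s)"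
  proof (rule set_lebesgue_integral_le [OF energy_diff(1) [OF st] st(2)])
    fix r assume r: "s \<le> r" "r \<le> t"
    then have "0 \<le> r" using st by simp
    moreover from this have "\<gamma> * energy \<alpha> t \<le> \<gamma> * energy \<alpha> r"
      using mono r \<gamma> by (intro mult_left_mono) auto
    ultimately show "(LINT p|(\<mu> r \<Otimes>\<^sub>M \<mu> r). dissipation \<alpha> p) / 2 \<le> - \<gamma> * energy \<alpha> t"
      using le [of r] by linarith
  qed
  then show "energy \<alpha> t - energy \<alpha> s \<le> - \<gamma> * (t - s) * energy \<alpha> t"
    using energy_diff(2) [OF st, of \<alpha>] by (simp add: algebra_simps)
qed

lemma dissipation_pointwise:
  assumes \<theta>: "\<theta> > 0" and \<kappa>: "\<kappa> = \<theta> * lw / (\<phi>M * lx)" and \<alpha>: "\<alpha> = 2 * lx / (lv * (1 + 2 * \<kappa>))"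
    and X: "X = fst (fst p - snd p)" and V: "V = snd (fst p - snd p)"
  shows "dissipation \<alpha> p \<le> - (\<alpha> * ((1 - \<theta>) * (lw * (X \<bullet> X))
    + (- 1 + \<theta> * lw * lv\<^sup>2 / (\<phi>M * lx\<^sup>2) * \<phi>m) * (V \<bullet> V)))"
proof -
  define q where "q = \<phi> (norm X)"
  have k: "kernel (fst p) (snd p) = - ((lw + lx * q) *\<^sub>R X + (lv * q) *\<^sub>R V)"
    by (simp add: kernel_def X V q_def algebra_simps)
  have f: "(fst p - snd p) \<bullet> flux \<alpha> (fst p - snd p) = 2 * lw * (X \<bullet> V) + \<alpha> * (V \<bullet> V)"
  proof -
    have "z \<bullet> flux \<alpha> z = 2 * lw * (fst z \<bullet> snd z) + \<alpha> * (snd z \<bullet> snd z)" for z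
      by (simp add: flux_def inner_prod_def inner_add_right inner_commute [of "snd z" "fst z"])
    then show ?thesis by (simp only: X V)
  qed
  have "dissipation \<alpha> p = 2 * lw * (X \<bullet> V) + \<alpha> * (V \<bullet> V)
      - ((lw + lx * q) * (\<alpha> * (X \<bullet> X) + 2 * (X \<bullet> V)) + lv * q * (\<alpha> * (X \<bullet> V) + 2 * (V \<bullet> V)))"
    unfolding dissipation_def f k X [symmetric] V [symmetric]
    by (simp add: inner_add_left inner_add_right inner_commute [of V X] inner_diff_left algebra_simps)
  also have "\<dots> \<le> - (\<alpha> * ((1 - \<theta>) * (lw * (X \<bullet> X))
    + (- 1 + \<theta> * lw * lv\<^sup>2 / (\<phi>M * lx\<^sup>2) * \<phi>m) * (V \<bullet> V)))"
    by (rule dissipation_le [OF lw lx lv \<phi>m_pos \<phi>M_pos \<theta> _ _ Cauchy_Schwarz_ineq _ _ \<kappa> \<alpha>])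
      (simp_all add: q_def \<phi>_ge \<phi>_le)
  finally show ?thesis .
qed

lemma variance_decay:
  assumes cond: "\<phi>M * lx\<^sup>2 / (\<phi>m * lw * lv\<^sup>2) < 1 / 2 * min 1 \<phi>M"
    and \<theta>: "\<theta> = 1 / 2 * min 1 \<phi>M"
    and \<alpha>: "\<alpha> = 2 * lx / (lv * (1 + 2 * (\<theta> * lw / (\<phi>M * lx))))"
    and \<beta>: "\<beta> = min (1 - \<theta>) (- 1 + \<theta> * lw * lv\<^sup>2 / (\<phi>M * lx\<^sup>2) * \<phi>m) * \<alpha> * \<delta>"
    and \<delta>: "0 < \<delta>" "\<delta> < 1"
  shows "\<beta> > 0"
    and "t \<ge> 0 \<Longrightarrow> variance t \<le> 8 * max 1 lw / min 1 lw * variance 0 * exp (- (\<beta> / 2) * t)"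
proof -
  define m where "m = min (1 - \<theta>) (- 1 + \<theta> * lw * lv\<^sup>2 / (\<phi>M * lx\<^sup>2) * \<phi>m)"
  define \<kappa> where "\<kappa> = \<theta> * lw / (\<phi>M * lx)"
  have \<theta>0: "\<theta> > 0" "\<theta> \<le> 1 / 2" using \<phi>M_pos by (auto simp: \<theta>)
  have \<kappa>0: "\<kappa> > 0" using \<theta>0 lw lx \<phi>M_pos by (simp add: \<kappa>_def)
  have \<alpha>': "\<alpha> = 2 * lx / (lv * (1 + 2 * \<kappa>))" by (simp add: \<alpha> \<kappa>_def)
  have \<alpha>0: "\<alpha> > 0" using \<kappa>0 lx lv by (simp add: \<alpha>' add_pos_pos)
  have "\<phi>M * lx\<^sup>2 / (\<phi>m * lw * lv\<^sup>2) < \<theta>" using cond by (simp add: \<theta>)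
  then have c: "\<phi>M * lx\<^sup>2 < \<theta> * (\<phi>m * lw * lv\<^sup>2)"
    using \<phi>m_pos lw lv by (simp add: divide_less_eq)
  then have "1 < \<theta> * (\<phi>m * lw * lv\<^sup>2) / (\<phi>M * lx\<^sup>2)"
    using \<phi>M_pos lx by (simp add: less_divide_eq)
  then have m0: "m > 0" using \<theta>0 by (simp add: m_def algebra_simps)
  show \<beta>0: "\<beta> > 0" using m0 \<alpha>0 \<delta> by (simp add: \<beta> m_def)
  \<comment> \<open>Dropping the factor \<open>1 + 2 * \<kappa>\<close> leaves
    \<open>2 * lx / lv\<close>. The smallness condition with \<open>\<theta> \<le> 1 / 2\<close> and
    \<open>\<phi>m \<le> \<phi>M\<close> bounds the square of that by \<open>2 * lw\<close>.\<close>
  have \<alpha>_sq: "\<alpha>\<^sup>2 \<le> 2 * lw"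
  proof -
    have "\<alpha> \<le> 2 * lx / lv"
      unfolding \<alpha>' using \<kappa>0 lx lv by (intro divide_left_mono) auto
    then have "\<alpha>\<^sup>2 \<le> (2 * lx / lv)\<^sup>2" using \<alpha>0 by (intro power_mono) auto
    also have "\<dots> = 4 * lx\<^sup>2 / lv\<^sup>2" by (simp add: power_divide power_mult_distrib)
    also have "\<dots> \<le> 2 * lw"
    proof -
      have "\<phi>M * lx\<^sup>2 \<le> \<theta> * (\<phi>m * lw * lv\<^sup>2)" using c by simp
      also have "\<dots> \<le> 1 / 2 * (\<phi>M * lw * lv\<^sup>2)"
        using \<theta>0 lw lv \<phi>m_pos \<phi>M_pos order_trans [OF \<phi>_ge \<phi>_le] by (intro mult_mono) auto
      finally have "\<phi>M * (2 * lx\<^sup>2) \<le> \<phi>M * (lw * lv\<^sup>2)" by (simp add: algebra_simps)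
      then have "2 * lx\<^sup>2 \<le> lw * lv\<^sup>2" using \<phi>M_pos by simp
      then show ?thesis using lv by (simp add: divide_le_eq)
    qed
    finally show ?thesis .
  qed
  have diss: "dissipation \<alpha> p \<le> - (\<beta> / 2) * ((fst p - snd p) \<bullet> gram \<alpha> (fst p - snd p))" for p
  proof -
    define X V where "X = fst (fst p - snd p)" and "V = snd (fst p - snd p)"
    define S where "S = lw * (X \<bullet> X) + V \<bullet> V"
    have S: "S \<ge> 0" using lw by (simp add: S_def)
    have "m * (lw * (X \<bullet> X)) \<le> (1 - \<theta>) * (lw * (X \<bullet> X))"
      using lw by (intro mult_right_mono) (auto simp: m_def)
    moreover have "m * (V \<bullet> V) \<le> (- 1 + \<theta> * lw * lv\<^sup>2 / (\<phi>M * lx\<^sup>2) * \<phi>m) * (V \<bullet> V)"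
      by (intro mult_right_mono) (auto simp: m_def)
    ultimately have "m * S \<le> (1 - \<theta>) * (lw * (X \<bullet> X)) + (- 1 + \<theta> * lw * lv\<^sup>2 / (\<phi>M * lx\<^sup>2) * \<phi>m) * (V \<bullet> V)"
      unfolding S_def distrib_left by (rule add_mono)
    then have "\<alpha> * (m * S) \<le> \<alpha> * ((1 - \<theta>) * (lw * (X \<bullet> X)) + (- 1 + \<theta> * lw * lv\<^sup>2 / (\<phi>M * lx\<^sup>2) * \<phi>m) * (V \<bullet> V))"
      using \<alpha>0 by (intro mult_left_mono) auto
    then have 1: "dissipation \<alpha> p \<le> - (\<alpha> * (m * S))"
      using dissipation_pointwise [OF \<theta>0(1) \<kappa>_def \<alpha>' X_def V_def] by linarith
    \<comment> \<open>The 2 of this upper comparison is the reason for \<beta>/2 in the exponent: it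
      cancels, leaving the pointwise rate times \<delta>, and \<delta> is below 1.\<close>
    have "(fst p - snd p) \<bullet> gram \<alpha> (fst p - snd p) \<le> 2 * S"
      using gram_bounds(2) [OF \<alpha>_sq, of "fst p - snd p"] by (simp add: S_def X_def V_def)
    then have "\<beta> / 2 * ((fst p - snd p) \<bullet> gram \<alpha> (fst p - snd p)) \<le> \<beta> / 2 * (2 * S)"
      using \<beta>0 by (intro mult_left_mono) auto
    also have "\<dots> = \<delta> * (\<alpha> * (m * S))" by (simp add: \<beta> m_def)
    also have "\<dots> \<le> 1 * (\<alpha> * (m * S))"
      using \<delta> \<alpha>0 m0 S by (intro mult_right_mono) auto
    finally show ?thesis using 1 by linarith
  qed
  assume t: "t \<ge> 0"
  have "min 1 lw / 4 * variance t \<le> energy \<alpha> t" by (rule energy_bounds(1) [OF \<alpha>_sq t])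
  also have "\<dots> \<le> energy \<alpha> 0 * exp (- (\<beta> / 2) * t)"
    using \<beta>0 by (intro energy_decay diss \<alpha>_sq t) auto
  also have "\<dots> \<le> (2 * max 1 lw * variance 0) * exp (- (\<beta> / 2) * t)"
    by (intro mult_right_mono energy_bounds(2) \<alpha>_sq) auto
  finally show "variance t \<le> 8 * max 1 lw / min 1 lw * variance 0 * exp (- (\<beta> / 2) * t)"
    using lw by (simp add: field_simps)
qed

end

theorem theorem1p4:
  fixes lw lx lv :: real
    and \<mu>0 :: "('d::finite) phase measure"
  assumes "lw > 0" and "lx > 0" and "lv > 0"
    and "finite_borel \<mu>0" and "compactly_supported \<mu>0" and "measure \<mu>0 UNIV = 1"
  shows "\<exists>C>0. \<forall>\<phi> \<phi>m \<phi>M \<delta> \<mu>.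
           communication_rate \<phi> \<phi>m \<phi>M \<longrightarrow>
           \<phi>M * lx\<^sup>2 / (\<phi>m * lw * lv\<^sup>2) < 1 / 2 * min 1 \<phi>M \<longrightarrow>
           global_solution lw lx lv \<phi> \<mu>0 \<mu> \<longrightarrow>
           (let \<theta> = 1 / 2 * min 1 \<phi>M;
                \<alpha> = 2 * lx / (lv * (1 + 2 * (\<theta> * lw / (\<phi>M * lx))));
                \<beta> = min (1 - \<theta>) (- 1 + \<theta> * lw * lv\<^sup>2 / (\<phi>M * lx\<^sup>2) * \<phi>m) * \<alpha> * \<delta>
            in 0 < \<delta> \<and> \<delta> < 1 \<and> \<delta>\<^sup>2 / (1 - \<delta>)\<^sup>2 < 4 * lw / \<alpha>\<^sup>2 \<longrightarrow>
               \<beta> > 0 \<and>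
               (\<forall>t\<ge>0.
                  integrable (\<mu> t) (\<lambda>(x, v). (norm (x - mean_x (\<mu> t)))\<^sup>2 + (norm (v - mean_v (\<mu> t)))\<^sup>2) \<and>
                  (LINT (x, v)|\<mu> t. (norm (x - mean_x (\<mu> t)))\<^sup>2 + (norm (v - mean_v (\<mu> t)))\<^sup>2)
                    \<le> C * exp (- (\<beta> / 2) * t)))"
proof -
  define I where "I = (LINT z|\<mu>0. z \<bullet> z) - (LINT z|\<mu>0. z) \<bullet> (LINT z|\<mu>0. z)"
  \<comment> \<open>\<open>I\<close> is the initial variance. It vanishes for a Dirac mass, hence
    the summand 1; the absolute value avoids a discussion of sign. No other data enter, so
    \<open>C\<close> can be fixed before the communication rate, \<delta> and the solution.\<close>
  define C where "C = 1 + \<bar>8 * max 1 lw / min 1 lw * I\<bar>"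
  have "C > 0" by (simp add: C_def add_pos_nonneg)
  moreover have "\<beta> > 0 \<and> (\<forall>t\<ge>0.
      integrable (\<mu> t) (\<lambda>(x, v). (norm (x - mean_x (\<mu> t)))\<^sup>2 + (norm (v - mean_v (\<mu> t)))\<^sup>2) \<and>
      (LINT (x, v)|\<mu> t. (norm (x - mean_x (\<mu> t)))\<^sup>2 + (norm (v - mean_v (\<mu> t)))\<^sup>2) \<le> C * exp (- (\<beta> / 2) * t))"
    if rate: "communication_rate \<phi> \<phi>m \<phi>M"
      and cond: "\<phi>M * lx\<^sup>2 / (\<phi>m * lw * lv\<^sup>2) < 1 / 2 * min 1 \<phi>M"
      and sol: "global_solution lw lx lv \<phi> \<mu>0 \<mu>"
      and \<theta>: "\<theta> = 1 / 2 * min 1 \<phi>M"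
      and \<alpha>: "\<alpha> = 2 * lx / (lv * (1 + 2 * (\<theta> * lw / (\<phi>M * lx))))"
      and \<beta>: "\<beta> = min (1 - \<theta>) (- 1 + \<theta> * lw * lv\<^sup>2 / (\<phi>M * lx\<^sup>2) * \<phi>m) * \<alpha> * \<delta>"
      and \<delta>: "0 < \<delta>" "\<delta> < 1"
    for \<phi> \<phi>m \<phi>M \<delta> \<mu> \<theta> \<alpha> \<beta>
  proof -
    interpret herding lw lx lv \<phi> \<phi>m \<phi>M \<mu>0 \<mu>
      by (rule herding.intro [OF assms(1-3) rate sol assms(5,6)])
    note decay = variance_decay [OF cond \<theta> \<alpha> \<beta> \<delta>]
    have dev: "(\<lambda>(x, v). (norm (x - mean_x (\<mu> t)))\<^sup>2 + (norm (v - mean_v (\<mu> t)))\<^sup>2) = (\<lambda>z. (z - mean t) \<bullet> (z - mean t))"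
      if "t \<ge> 0" for t
      using that by (simp add: fun_eq_iff fst_mean snd_mean power2_norm_eq_inner inner_prod_def [of "_ - _"])
    have "(LINT (x, v)|\<mu> t. (norm (x - mean_x (\<mu> t)))\<^sup>2 + (norm (v - mean_v (\<mu> t)))\<^sup>2) \<le> C * exp (- (\<beta> / 2) * t)"
      if t: "t \<ge> 0" for t
    proof -
      have "variance t \<le> (8 * max 1 lw / min 1 lw * I) * exp (- (\<beta> / 2) * t)"
        using decay(2) [OF t] by (simp add: variance_def mean_def mu_0 I_def)
      also have "\<dots> \<le> C * exp (- (\<beta> / 2) * t)"
        by (intro mult_right_mono) (auto simp: C_def intro: order_trans [OF abs_ge_self])
      finally show ?thesis
        unfolding dev [OF t] integral_deviation(2) [OF t] .
    qed
    moreover have "integrable (\<mu> t) (\<lambda>(x, v). (norm (x - mean_x (\<mu> t)))\<^sup>2 + (norm (v - mean_v (\<mu> t)))\<^sup>2)"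
      if t: "t \<ge> 0" for t
      unfolding dev [OF t] by (rule integral_deviation(1) [OF t])
    ultimately show ?thesis using decay(1) by blast
  qed
  ultimately show ?thesis
    unfolding Let_def by (intro exI [of _ C] conjI allI impI) (blast+)
qed

end
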